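(* Let $\tau$ be a layered permutation of length $\ell\ge 1$. Then its Stanley–Wilf limit satisfies $L(\tau)\le 4\ell^2$.
   Context: A permutation of length $n$ is written as a word $\pi_1\pi_2\cdots\pi_n$ in the letters $1,\dots,n$. A permutation $\pi$ of length $n$ contains a permutation (pattern) $\tau$ of length $k$ if there are indices $i_1<\cdots<i_k$ such that $\pi_{i_1}\cdots\pi_{i_k}$ is order-isomorphic to $\tau$; otherwise $\pi$ avoids $\tau$. Let $S_n(\tau)$ denote the number of permutations of length $n$ avoiding $\tau$. The Stanley–Wilf limit of $\tau$ is $L(\tau)=\lim_{n\to\infty} S_n(\tau)^{1/n}$ (this limit is known to exist and be finite for every pattern $\tau$). A permutation is layered if it is a concatenation of decreasing sequences (layers), the letters of each sequence being smaller than the letters in the following sequences; equivalently, it is a direct sum of decreasing permutations. For example $321465798$ is layered with layers $321$, $4$, $65$, $7$, $98$. Here the direct sum $\sigma\oplus\rho$ of permutations $\sigma$ of length $k$ and $\rho$ of length $m$ is the permutation of length $k+m$ with $(\sigma\oplus\rho)(i)=\sigma(i)$ for $i\le k$ and $(\sigma\oplus\rho)(i)=\rho(i-k)+k$ for $i>k$. *)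

theory Defs
  imports Complex_Main "HOL-Combinatorics.Multiset_Permutations"
begin

text \<open>
  A permutation of length \<open>n\<close> is the word of its values, i.e. an element of
  \<^term>\<open>permutations_of_set {1..n}\<close>. List positions are counted from 0, values from 1.
\<close>

definition contains_pattern :: "nat list \<Rightarrow> nat list \<Rightarrow> bool" where
  "contains_pattern \<pi> \<tau> \<longleftrightarrow>
     (\<exists>f :: nat \<Rightarrow> nat.
        strict_mono_on {..<length \<tau>} f \<and>
        (\<forall>i<length \<tau>. f i < length \<pi>) \<and>
        (\<forall>i<length \<tau>. \<forall>j<length \<tau>. \<pi> ! f i < \<pi> ! f j \<longleftrightarrow> \<tau> ! i < \<tau> ! j))"

definition avoids_pattern :: "nat list \<Rightarrow> nat list \<Rightarrow> bool" where
  "avoids_pattern \<pi> \<tau> \<longleftrightarrow> \<not> contains_pattern \<pi> \<tau>"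

definition num_avoiders :: "nat \<Rightarrow> nat list \<Rightarrow> nat" where
  "num_avoiders n \<tau> = card {\<pi> \<in> permutations_of_set {1..n}. avoids_pattern \<pi> \<tau>}"

definition stanley_wilf_limit :: "nat list \<Rightarrow> real" where
  "stanley_wilf_limit \<tau> = lim (\<lambda>n. root n (real (num_avoiders n \<tau>)))"

definition layered :: "nat list \<Rightarrow> bool" where
  "layered \<tau> \<longleftrightarrow>
     (\<exists>layers. \<tau> = concat layers \<and>
        (\<forall>s\<in>set layers. sorted_wrt (>) s) \<and>
        sorted_wrt (\<lambda>s t. \<forall>x\<in>set s. \<forall>y\<in>set t. x < y) layers)"

end

theory Submission
  imports Defs "HOL-Library.Sublist"
begin

text \<open>
  Every letter of a permutation has a position and a value. Suppose that the members of a class of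
  permutations can be described by colouring the positions and the values with \<open>c\<close> colours, in such
  a way that the two colourings determine the permutation (\<open>codable\<close>). Then there are at most
  \<open>c ^ (2 * n)\<close> members of length \<open>n\<close>, and their growth rate is at most \<open>c\<^sup>2\<close>. It thus suffices to describe
  the avoiders of a layered pattern of length \<open>l\<close> with \<open>2 l\<close> colours. The merit of such codes is that
  colour counts add up under merging: if each permutation of a class is a shuffle of a red word from
  one class and a blue word from another, then using disjoint palettes codes the whole class
  (\<open>codable_merge\<close>).

  Shuffles arise from a lemma of Claesson, Jelinek and Steingrimsson (\<open>avoider_splits\<close>): if \<open>T\<close> is
  nonempty, an avoider of \<open>S \<oplus> T \<oplus> R\<close> is a shuffle of an avoider of \<open>S \<oplus> T\<close> and an avoider of \<open>T \<oplus> R\<close>.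
  Write \<open>\<delta>\<^sub>k\<close> for the decreasing pattern of length \<open>k\<close>, and let \<open>\<lambda>\<close> be the direct sum of the layers
  after a first layer \<open>\<delta>\<^sub>k\<close>. An avoider of \<open>1 \<oplus> \<delta>\<^sub>k \<oplus> \<lambda>\<close> splits into an avoider of \<open>1 \<oplus> \<delta>\<^sub>k\<close> and one of
  \<open>\<delta>\<^sub>k \<oplus> \<lambda>\<close>. The latter also avoids \<open>\<delta>\<^sub>k \<oplus> 1 \<oplus> \<lambda>\<close>, and so splits into an avoider of \<open>\<delta>\<^sub>k \<oplus> 1\<close> and one of
  \<open>1 \<oplus> \<lambda>\<close>. If the avoiders of \<open>1 \<oplus> \<delta>\<^sub>k\<close> and of \<open>\<delta>\<^sub>k \<oplus> 1\<close> are codable with \<open>k\<close> colours, then each layer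
  costs twice its length, as wanted (\<open>codable_one_layered\<close>).

  The avoiders of \<open>\<delta>\<^sub>k \<oplus> 1\<close> are coded by Schensted insertion (\<open>codable_decreasing_one\<close>). Scanning the word
  from left to right, the letters already seen that lie below some letter still to come contain
  no \<open>\<delta>\<^sub>k\<close>, so their insertion tableau has at most \<open>k - 1\<close> rows. A letter enters the tableau when it is
  read, which lengthens one row, and it is discarded when no larger letter remains; since the
  largest letters go first, a discarded letter sits at the end of its row. The position colour is the row
  that was lengthened, the value colour is the row from which the letter is discarded, and one more
  colour marks the right-to-left maxima, which never enter the tableau. Insertion can be undone once
  the lengthened row is known, so the word can be read off backwards. Reversing and complementing
  handles \<open>1 \<oplus> \<delta>\<^sub>k\<close>.

  Since the Stanley-Wilf limit is defined by \<open>lim\<close>, an upper bound for the sequence is of use only once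
  the sequence is known to converge. This follows Arratia: if the first letter of the pattern is
  smaller than the last, the avoiders are closed under skew sums, and if it is larger, they are closed
  under direct sums. The counting sequence is therefore supermultiplicative
  (\<open>num_avoiders_supermult\<close>), and Fekete's lemma applies.
\<close>

section \<open>Subsequences\<close>

lemma subseq_subset: "subseq d w \<Longrightarrow> set d \<subseteq> set w"
  by (auto elim!: list_emb_set)

lemma sorted_wrt_subseq: "subseq d w \<Longrightarrow> sorted_wrt P w \<Longrightarrow> sorted_wrt P d"
  by (induction rule: list_emb.induct) (auto dest: subseq_subset)

lemma subseq_appendD:
  assumes "subseq (a @ b) w"
  shows "subseq a w" "subseq b w"
proof -
  have "subseq a (a @ b)" "subseq b (a @ b)"
    by (auto intro: subseq_rev_drop_many)
  then show "subseq a w" "subseq b w"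
    using assms by (blast intro: subseq_order.trans)+
qed

lemma subseq_snocE:
  assumes "subseq d (e @ [x])" "\<not> subseq d e"
  obtains d' where "d = d' @ [x]" "subseq d' e"
proof -
  obtain d1 d2 where d: "d = d1 @ d2" "subseq d1 e" "subseq d2 [x]"
    using assms(1) by (auto simp: subseq_append_iff)
  have "d2 \<noteq> []"
    using d assms(2) by auto
  then have "d2 = [x]"
    using d(3) by (cases d2) (auto elim: list_emb.cases split: if_splits)
  then show thesis
    using d that by blast
qed

lemma subseq_skip_prefix:
  assumes "subseq (x # xs) (u @ v)" "x \<notin> set u"
  shows "subseq (x # xs) v"
  using assms by (induction u) auto

lemma subseq_split_at:
  assumes "subseq (a @ z # b) (u @ z # v)" "z \<notin> set u" "z \<notin> set v"
  shows "subseq a u" "subseq b v"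
proof -
  obtain d1 d2 where d: "a @ z # b = d1 @ d2" "subseq d1 u" "subseq d2 (z # v)"
    using assms(1) by (auto simp: subseq_append_iff)
  have "z \<notin> set d1"
    using list_emb_set[OF d(2)] assms(2) by auto
  then obtain e where e: "a = d1 @ e" "d2 = e @ z # b"
    using d(1) by (force simp: append_eq_append_conv2 Cons_eq_append_conv)
  have "e = []"
  proof (rule ccontr)
    assume "e \<noteq> []"
    then obtain y e' where "e = y # e'"
      by (cases e) auto
    then have "subseq (e' @ z # b) v"
      using d(3) e(2) by (auto split: if_splits dest: subseq_Cons')
    then show False
      using list_emb_set[of "(=)" "e' @ z # b" v z] assms(3) by auto
  qed
  then show "subseq a u" "subseq b v"
    using d e by auto
qed

lemma subseq_rev: "subseq d w \<Longrightarrow> subseq (rev d) (rev w)"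
  by (induction rule: list_emb.induct) (auto intro: subseq_rev_drop_many list_emb_append_mono)

section \<open>Direct sums of sets of words\<close>

definition direct_sum :: "nat list set \<Rightarrow> nat list set \<Rightarrow> nat list set"  (infixr "\<oplus>" 65) where
  "S \<oplus> T = {s @ t | s t. s \<in> S \<and> t \<in> T \<and> (\<forall>x\<in>set s. \<forall>y\<in>set t. x < y)}"

definition decreasing_words :: "nat \<Rightarrow> nat list set" where
  "decreasing_words k = {d. length d = k \<and> sorted_wrt (>) d}"

text \<open>
  Patterns are represented by the sets of all words that are order-isomorphic to them, so that
  avoidance becomes a statement about subsequences. The splitting argument works for arbitrary
  sets of words.
\<close>
definition avoids_all :: "nat list set \<Rightarrow> nat list \<Rightarrow> bool" where
  "avoids_all S w \<longleftrightarrow> (\<forall>s\<in>S. \<not> subseq s w)"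

lemma direct_sumI:
  "s \<in> S \<Longrightarrow> t \<in> T \<Longrightarrow> (\<And>x y. x \<in> set s \<Longrightarrow> y \<in> set t \<Longrightarrow> x < y) \<Longrightarrow> s @ t \<in> S \<oplus> T"
  by (auto simp: direct_sum_def)

lemma direct_sumE:
  assumes "r \<in> S \<oplus> T"
  obtains s t where "r = s @ t" "s \<in> S" "t \<in> T" "\<And>x y. x \<in> set s \<Longrightarrow> y \<in> set t \<Longrightarrow> x < y"
  using assms by (auto simp: direct_sum_def)

section \<open>Coding permutations by coloured positions and values\<close>

text \<open>
  The colours \<open>p w x\<close> and \<open>q w x\<close> belong to the position and to the value of the letter \<open>x\<close> of \<open>w\<close>. A
  decoder sees the position colours in reading order and the value colours as a function
  on the set of letters.
\<close>
definition codable :: "nat \<Rightarrow> (nat list \<Rightarrow> bool) \<Rightarrow> bool" where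
  "codable c P \<longleftrightarrow>
     (\<exists>p q :: nat list \<Rightarrow> nat \<Rightarrow> nat.
        (\<forall>w x. P w \<longrightarrow> distinct w \<longrightarrow> x \<in> set w \<longrightarrow> p w x < c \<and> q w x < c) \<and>
        (\<forall>w w'. P w \<longrightarrow> P w' \<longrightarrow> distinct w \<longrightarrow> distinct w' \<longrightarrow> set w = set w' \<longrightarrow>
            map (p w) w = map (p w') w' \<longrightarrow> (\<forall>x\<in>set w. q w x = q w' x) \<longrightarrow> w = w'))"

lemma codable_mono:
  assumes "codable c P" "c \<le> d" "\<And>w. Q w \<Longrightarrow> P w"
  shows "codable d Q"
proof -
  obtain p q where
    1: "\<And>w x. P w \<Longrightarrow> distinct w \<Longrightarrow> x \<in> set w \<Longrightarrow> p w x < c \<and> q w x < c" and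
    2: "\<And>w w'. P w \<Longrightarrow> P w' \<Longrightarrow> distinct w \<Longrightarrow> distinct w' \<Longrightarrow> set w = set w' \<Longrightarrow>
          map (p w) w = map (p w') w' \<Longrightarrow> \<forall>x\<in>set w. q w x = q w' x \<Longrightarrow> w = w'"
    using assms(1) unfolding codable_def by blast
  show ?thesis
    unfolding codable_def
    by (rule exI[of _ p], rule exI[of _ q]) (use 1 2 assms(2,3) in \<open>meson order.strict_trans2\<close>)
qed

lemma merge_unique:
  assumes "map (\<lambda>x. x \<in> A) w = map (\<lambda>x. x \<in> A) w'"
    and "filter (\<lambda>x. x \<in> A) w = filter (\<lambda>x. x \<in> A) w'"
    and "filter (\<lambda>x. x \<notin> A) w = filter (\<lambda>x. x \<notin> A) w'"
  shows "w = w'"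
proof -
  have "length w = length w'"
    using assms(1) by (metis length_map)
  then show ?thesis
    using assms by (induction w w' rule: list_induct2) (auto split: if_splits)
qed

text \<open>
  The palettes are made disjoint by adding \<open>c1\<close> to the blue colours. The value colours then reveal which
  letters are red, the position colours reveal at which positions they stand, and the two
  subwords are decoded separately.
\<close>
lemma codable_merge:
  assumes P1: "codable c1 P1" and P2: "codable c2 P2"
    and split: "\<And>w. P w \<Longrightarrow> distinct w \<Longrightarrow>
      \<exists>A. P1 (filter (\<lambda>x. x \<in> A) w) \<and> P2 (filter (\<lambda>x. x \<notin> A) w)"
  shows "codable (c1 + c2) P"
proof -
  obtain p1 q1 where
    r1: "\<And>w x. P1 w \<Longrightarrow> distinct w \<Longrightarrow> x \<in> set w \<Longrightarrow> p1 w x < c1 \<and> q1 w x < c1" and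
    u1: "\<And>w w'. P1 w \<Longrightarrow> P1 w' \<Longrightarrow> distinct w \<Longrightarrow> distinct w' \<Longrightarrow> set w = set w' \<Longrightarrow>
          map (p1 w) w = map (p1 w') w' \<Longrightarrow> \<forall>x\<in>set w. q1 w x = q1 w' x \<Longrightarrow> w = w'"
    using P1 unfolding codable_def by blast
  obtain p2 q2 where
    r2: "\<And>w x. P2 w \<Longrightarrow> distinct w \<Longrightarrow> x \<in> set w \<Longrightarrow> p2 w x < c2 \<and> q2 w x < c2" and
    u2: "\<And>w w'. P2 w \<Longrightarrow> P2 w' \<Longrightarrow> distinct w \<Longrightarrow> distinct w' \<Longrightarrow> set w = set w' \<Longrightarrow>
          map (p2 w) w = map (p2 w') w' \<Longrightarrow> \<forall>x\<in>set w. q2 w x = q2 w' x \<Longrightarrow> w = w'"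
    using P2 unfolding codable_def by blast
  obtain A where A: "\<And>w. P w \<Longrightarrow> distinct w \<Longrightarrow>
      P1 (filter (\<lambda>x. x \<in> A w) w) \<and> P2 (filter (\<lambda>x. x \<notin> A w) w)"
    using split by metis
  define red where "red w = filter (\<lambda>x. x \<in> A w) w" for w
  define blue where "blue w = filter (\<lambda>x. x \<notin> A w) w" for w
  define p where "p w x = (if x \<in> A w then p1 (red w) x else c1 + p2 (blue w) x)" for w x
  define q where "q w x = (if x \<in> A w then q1 (red w) x else c1 + q2 (blue w) x)" for w x
  have cls: "P1 (red w)" "P2 (blue w)" "distinct (red w)" "distinct (blue w)"
    if "P w" "distinct w" for w
    using A that by (auto simp: red_def blue_def)
  have b1: "p1 (red w) x < c1" "q1 (red w) x < c1"
    if "P w" "distinct w" "x \<in> set w" "x \<in> A w" for w x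
    using r1[OF cls(1,3)[OF that(1,2)], of x] that by (auto simp: red_def)
  have b2: "p2 (blue w) x < c2" "q2 (blue w) x < c2"
    if "P w" "distinct w" "x \<in> set w" "x \<notin> A w" for w x
    using r2[OF cls(2,4)[OF that(1,2)], of x] that by (auto simp: blue_def)
  have range: "p w x < c1 + c2 \<and> q w x < c1 + c2" if "P w" "distinct w" "x \<in> set w" for w x
    using b1[OF that] b2[OF that] by (auto simp: p_def q_def)
  have small: "p w x < c1 \<longleftrightarrow> x \<in> A w" "q w x < c1 \<longleftrightarrow> x \<in> A w"
    if "P w" "distinct w" "x \<in> set w" for w x
    using b1[OF that] by (auto simp: p_def q_def)
  have uniq: "w = w'"
    if w: "P w" "distinct w" and w': "P w'" "distinct w'" and sets: "set w = set w'"
      and pos: "map (p w) w = map (p w') w'" and val: "\<forall>x\<in>set w. q w x = q w' x" for w w'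
  proof -
    have same: "x \<in> A w \<longleftrightarrow> x \<in> A w'" if "x \<in> set w" for x
      using small(2)[OF w that] small(2)[OF w'] that sets val by auto
    have red': "red w' = filter (\<lambda>x. x \<in> A w) w'" and blue': "blue w' = filter (\<lambda>x. x \<notin> A w) w'"
      using same sets by (auto simp: red_def blue_def intro!: filter_cong)
    have fr: "map (p1 (red v)) (red v) = filter (\<lambda>i. i < c1) (map (p v) v)"
      if "P v" "distinct v" for v
    proof -
      have "filter (\<lambda>i. i < c1) (map (p v) v) = map (p v) (filter (\<lambda>x. p v x < c1) v)"
        by (simp add: filter_map comp_def)
      also have "filter (\<lambda>x. p v x < c1) v = red v"
        unfolding red_def using small(1)[OF that] by (intro filter_cong) auto
      also have "map (p v) (red v) = map (p1 (red v)) (red v)"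
        by (auto simp: p_def red_def)
      finally show ?thesis by simp
    qed
    have fb: "map (\<lambda>x. c1 + p2 (blue v) x) (blue v) = filter (\<lambda>i. \<not> i < c1) (map (p v) v)"
      if "P v" "distinct v" for v
    proof -
      have "filter (\<lambda>i. \<not> i < c1) (map (p v) v) = map (p v) (filter (\<lambda>x. \<not> p v x < c1) v)"
        by (simp add: filter_map comp_def)
      also have "filter (\<lambda>x. \<not> p v x < c1) v = blue v"
        unfolding blue_def using small(1)[OF that] by (intro filter_cong) auto
      also have "map (p v) (blue v) = map (\<lambda>x. c1 + p2 (blue v) x) (blue v)"
        by (auto simp: p_def blue_def)
      finally show ?thesis by simp
    qed
    have "red w = red w'"
    proof (rule u1[OF cls(1)[OF w] cls(1)[OF w'] cls(3)[OF w] cls(3)[OF w']])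
      show "set (red w) = set (red w')"
        unfolding red' using sets by (auto simp: red_def)
      show "map (p1 (red w)) (red w) = map (p1 (red w')) (red w')"
        using fr[OF w] fr[OF w'] pos by simp
      show "\<forall>x\<in>set (red w). q1 (red w) x = q1 (red w') x"
        using val same by (auto simp: red_def q_def)
    qed
    moreover have "blue w = blue w'"
    proof (rule u2[OF cls(2)[OF w] cls(2)[OF w'] cls(4)[OF w] cls(4)[OF w']])
      show "set (blue w) = set (blue w')"
        unfolding blue' using sets by (auto simp: blue_def)
      have "map (\<lambda>x. c1 + p2 (blue w) x) (blue w) = map (\<lambda>x. c1 + p2 (blue w') x) (blue w')"
        using fb[OF w] fb[OF w'] pos by simp
      then have "map (\<lambda>i. i - c1) (map (\<lambda>x. c1 + p2 (blue w) x) (blue w)) =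
          map (\<lambda>i. i - c1) (map (\<lambda>x. c1 + p2 (blue w') x) (blue w'))"
        by simp
      then show "map (p2 (blue w)) (blue w) = map (p2 (blue w')) (blue w')"
        by (simp add: comp_def)
      show "\<forall>x\<in>set (blue w). q2 (blue w) x = q2 (blue w') x"
        using val same by (auto simp: blue_def q_def)
    qed
    moreover have "map (\<lambda>x. x \<in> A w) w = map (\<lambda>x. x \<in> A w) w'"
    proof -
      have *: "map (\<lambda>x. x \<in> A v) v = map (\<lambda>i. i < c1) (map (p v) v)" if "P v" "distinct v" for v
        using small(1)[OF that] by simp
      have "map (\<lambda>x. x \<in> A w) w' = map (\<lambda>x. x \<in> A w') w'"
        using same sets by simp
      then show ?thesis
        using *[OF w] *[OF w'] pos by simp
    qed
    ultimately show ?thesis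
      using merge_unique[of "A w" w w'] red' blue' by (simp add: red_def blue_def)
  qed
  show ?thesis
    unfolding codable_def
    by (rule exI[of _ p], rule exI[of _ q], intro conjI allI impI)
      (use range in blast, use range in blast, rule uniq)
qed

text \<open>A code for a permutation of \<open>{1..n}\<close> is a pair of words of length \<open>n\<close> in the colours.\<close>
lemma card_codable:
  assumes "codable c P"
  shows "card {w \<in> permutations_of_set {1..n}. P w} \<le> (c\<^sup>2) ^ n"
proof -
  obtain p q where
    r: "\<And>w x. P w \<Longrightarrow> distinct w \<Longrightarrow> x \<in> set w \<Longrightarrow> p w x < c \<and> q w x < c" and
    u: "\<And>w w'. P w \<Longrightarrow> P w' \<Longrightarrow> distinct w \<Longrightarrow> distinct w' \<Longrightarrow> set w = set w' \<Longrightarrow>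
          map (p w) w = map (p w') w' \<Longrightarrow> \<forall>x\<in>set w. q w x = q w' x \<Longrightarrow> w = w'"
    using assms unfolding codable_def by blast
  define A where "A = {w \<in> permutations_of_set {1..n}. P w}"
  define L where "L = {xs :: nat list. set xs \<subseteq> {..<c} \<and> length xs = n}"
  define code where "code w = (map (p w) w, map (q w) [1..<Suc n])" for w
  have A: "set w = {1..n}" "distinct w" "P w" "length w = n" if "w \<in> A" for w
    using that permutations_of_setD[of w "{1..n}"] distinct_card[of w] by (auto simp: A_def)
  have "inj_on code A"
  proof (rule inj_onI)
    fix w w' assume w: "w \<in> A" and w': "w' \<in> A" and eq: "code w = code w'"
    have val: "\<forall>x\<in>set w. q w x = q w' x"
    proof -
      have "map (q w) [1..<Suc n] = map (q w') [1..<Suc n]"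
        using eq by (simp only: code_def prod.inject)
      then have "\<forall>x\<in>set [1..<Suc n]. q w x = q w' x"
        by (simp only: map_eq_conv)
      then show ?thesis
        using A(1)[OF w] by auto
    qed
    have pos: "map (p w) w = map (p w') w'"
      using eq by (simp only: code_def prod.inject)
    show "w = w'"
      by (rule u[OF A(3)[OF w] A(3)[OF w'] A(2)[OF w] A(2)[OF w'] _ pos val])
        (simp add: A(1)[OF w] A(1)[OF w'])
  qed
  moreover have "code ` A \<subseteq> L \<times> L"
  proof (rule image_subsetI)
    fix w assume w: "w \<in> A"
    have pq: "p w x < c" "q w x < c" if "x \<in> {1..n}" for x
      using r[OF A(3,2)[OF w], of x] A(1)[OF w] that by simp_all
    have "set (map (p w) w) \<subseteq> {..<c}"
      using pq A(1)[OF w] by auto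
    moreover have "set (map (q w) [1..<Suc n]) \<subseteq> {..<c}"
      using pq by (auto simp del: upt_Suc)
    ultimately show "code w \<in> L \<times> L"
      unfolding code_def L_def using A(4)[OF w] by (simp del: set_map upt_Suc)
  qed
  moreover have "finite L" "card L = c ^ n"
    unfolding L_def using finite_lists_length_eq[of "{..<c}" n] card_lists_length_eq[of "{..<c}" n] by auto
  ultimately have "card A \<le> c ^ n * c ^ n"
    using card_inj_on_le[of code A "L \<times> L"] by (simp add: card_cartesian_product)
  then show ?thesis
    unfolding A_def by (simp add: power2_eq_square power_mult_distrib)
qed

section \<open>Splitting the avoiders of a direct sum\<close>

text \<open>
  The invariant for a blue letter \<open>x\<close> that follows the prefix \<open>u\<close>: weakly below \<open>x\<close> and not to its right there is
  a letter that ends a copy of \<open>S \<oplus> T\<close> whose \<open>T\<close>-part is otherwise red. That last letter is the one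
  which the greedy rule had to colour blue; \<open>x\<close> itself may be blue only because it lies above it.
\<close>
definition dominates_copy :: "nat list set \<Rightarrow> nat list set \<Rightarrow> nat set \<Rightarrow> nat list \<Rightarrow> nat \<Rightarrow> bool" where
  "dominates_copy S T A u x \<longleftrightarrow>
     (\<exists>s t. s \<in> S \<and> t \<in> T \<and> (\<forall>y\<in>set s. \<forall>z\<in>set t. y < z) \<and> subseq (s @ t) (u @ [x]) \<and>
        last t \<le> x \<and> set (butlast t) \<subseteq> A)"

text \<open>
  The letters in \<open>A\<close> are the red ones. The last clause says that blue spreads upwards and to the
  right.
\<close>
definition greedy_colouring :: "nat list set \<Rightarrow> nat list set \<Rightarrow> nat list \<Rightarrow> nat set \<Rightarrow> bool" where
  "greedy_colouring S T w A \<longleftrightarrow>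
     A \<subseteq> set w \<and> avoids_all (S \<oplus> T) (filter (\<lambda>x. x \<in> A) w) \<and>
     (\<forall>u x v. w = u @ x # v \<longrightarrow> x \<notin> A \<longrightarrow> dominates_copy S T A u x) \<and>
     (\<forall>u x v. w = u @ x # v \<longrightarrow> x \<in> A \<longrightarrow> (\<forall>y\<in>set u. y < x \<longrightarrow> y \<in> A))"

lemma greedy_colouring_blue:
  "greedy_colouring S T w A \<Longrightarrow> w = u @ x # v \<Longrightarrow> x \<notin> A \<Longrightarrow> dominates_copy S T A u x"
  unfolding greedy_colouring_def by metis

lemma greedy_colouring_red:
  "greedy_colouring S T w A \<Longrightarrow> w = u @ x # v \<Longrightarrow> x \<in> A \<Longrightarrow> y \<in> set u \<Longrightarrow> y < x \<Longrightarrow> y \<in> A"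
  unfolding greedy_colouring_def by metis

text \<open>
  The letters are coloured from left to right. A new letter becomes blue if a smaller letter before it
  is blue, or if painting it red would complete a red copy of \<open>S \<oplus> T\<close>; otherwise it becomes red.
\<close>
lemma greedy_colouring_exists:
  assumes "distinct w" "[] \<notin> T"
  shows "\<exists>A. greedy_colouring S T w A"
  using assms(1)
proof (induction w rule: rev_induct)
  case Nil
  then show ?case
    using assms(2) by (intro exI[of _ "{}"]) (auto simp: greedy_colouring_def avoids_all_def direct_sum_def dest: list_emb_length)
next
  case (snoc x w)
  have x: "x \<notin> set w" and "distinct w"
    using snoc.prems by auto
  then obtain A where gA: "greedy_colouring S T w A"
    using snoc.IH by blast
  then have A: "A \<subseteq> set w" "avoids_all (S \<oplus> T) (filter (\<lambda>x. x \<in> A) w)"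
    by (simp_all add: greedy_colouring_def)
  note blue = greedy_colouring_blue[OF gA] and red = greedy_colouring_red[OF gA]
  have xA: "x \<notin> A"
    using A x by auto
  have split: "(u = w \<and> z = x \<and> v = []) \<or> (\<exists>v'. v = v' @ [x] \<and> w = u @ z # v')"
    if "w @ [x] = u @ z # v" for u z v
    using that by (cases v rule: rev_cases) auto
  \<comment> \<open>the case in which the new letter becomes blue\<close>
  have keep: ?case if "dominates_copy S T A w x"
    unfolding greedy_colouring_def
  proof (rule exI[of _ A], intro conjI allI impI ballI)
    show "A \<subseteq> set (w @ [x])"
      using A by auto
    show "avoids_all (S \<oplus> T) (filter (\<lambda>x. x \<in> A) (w @ [x]))"
      using A(2) xA by simp
  next
    fix u z v assume "w @ [x] = u @ z # v" "z \<notin> A"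
    then show "dominates_copy S T A u z"
      using split[of u z v] that blue[of u z] by metis
  next
    fix u z v y assume "w @ [x] = u @ z # v" "z \<in> A" "y \<in> set u" "y < z"
    then show "y \<in> A"
      using split[of u z v] xA red[of u z _ y] by metis
  qed
  show ?case
  proof (cases "\<exists>y\<in>set w. y \<notin> A \<and> y < x")
    case True
    then obtain y u v where y: "y \<notin> A" "y < x" "w = u @ y # v"
      by (metis split_list)
    obtain s t where st: "s \<in> S" "t \<in> T" "\<forall>y\<in>set s. \<forall>z\<in>set t. y < z" "subseq (s @ t) (u @ [y])"
      "last t \<le> y" "set (butlast t) \<subseteq> A"
      using blue[OF y(3,1)] by (auto simp: dominates_copy_def)
    have "subseq (u @ [y]) (w @ [x])"
      using y(3) by (simp add: subseq_append_iff) (metis append_Cons append_Nil list_emb_append2 subseq_order.refl list_emb_append_mono)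
    then have "dominates_copy S T A w x"
      unfolding dominates_copy_def using st y(2)
      by (intro exI[of _ s] exI[of _ t]) (auto intro: subseq_order.trans)
    then show ?thesis
      by (rule keep)
  next
    case no_small: False
    show ?thesis
    proof (cases "avoids_all (S \<oplus> T) (filter (\<lambda>x. x \<in> A) w @ [x])")
      case False
      then obtain d where d: "d \<in> S \<oplus> T" "subseq d (filter (\<lambda>x. x \<in> A) w @ [x])"
        by (auto simp: avoids_all_def)
      obtain s t where st: "d = s @ t" "s \<in> S" "t \<in> T" "\<And>x y. x \<in> set s \<Longrightarrow> y \<in> set t \<Longrightarrow> x < y"
        using direct_sumE[OF d(1)] by metis
      have "t \<noteq> []"
        using st(3) assms(2) by auto
      obtain d' where d': "d = d' @ [x]" "subseq d' (filter (\<lambda>x. x \<in> A) w)"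
        using d A(2) by (auto simp: avoids_all_def elim: subseq_snocE)
      have last: "last t = x" "d' = s @ butlast t"
        using d'(1) st(1) \<open>t \<noteq> []\<close> by (metis last_append last_snoc, metis butlast_append butlast_snoc)
      have "set (butlast t) \<subseteq> A"
        using list_emb_set[OF d'(2)] last(2) by auto
      moreover have "subseq (s @ t) (w @ [x])"
        using d(2) st(1) by (metis list_emb_append_mono subseq_filter_left subseq_order.refl subseq_order.trans)
      ultimately have "dominates_copy S T A w x"
        unfolding dominates_copy_def using st last by (intro exI[of _ s] exI[of _ t]) auto
      then show ?thesis
        by (rule keep)
    next
      case True
      show ?thesis
        unfolding greedy_colouring_def
      proof (rule exI[of _ "insert x A"], intro conjI allI impI ballI)
        show "insert x A \<subseteq> set (w @ [x])"
          using A by auto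
        have "filter (\<lambda>z. z \<in> insert x A) (w @ [x]) = filter (\<lambda>x. x \<in> A) w @ [x]"
          using x by (auto intro!: filter_cong)
        then show "avoids_all (S \<oplus> T) (filter (\<lambda>z. z \<in> insert x A) (w @ [x]))"
          using True by simp
      next
        fix u z v assume "w @ [x] = u @ z # v" "z \<notin> insert x A"
        then have "dominates_copy S T A u z"
          using split[of u z v] blue[of u z] by blast
        then show "dominates_copy S T (insert x A) u z"
          unfolding dominates_copy_def by (meson subset_insertI2)
      next
        fix u z v y assume "w @ [x] = u @ z # v" "z \<in> insert x A" "y \<in> set u" "y < z"
        then show "y \<in> insert x A"
          using split[of u z v] x no_small red[of u z _ y] by (metis in_set_conv_decomp insert_iff)
      qed
    qed
  qed
qed

text \<open>
  In a blue copy \<open>t' @ r\<close> of \<open>T \<oplus> R\<close>, let \<open>a\<close> be the smallest letter of \<open>t'\<close>. The invariant supplies a copy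
  \<open>s @ t\<close> of \<open>S \<oplus> T\<close> that ends weakly below \<open>a\<close> and not to its right. If \<open>t\<close> lies below \<open>r\<close>, then
  \<open>s @ t @ r\<close> is a forbidden copy. Otherwise some red letter \<open>z\<close> of \<open>t\<close> exceeds a letter of \<open>r\<close> and hence all
  of \<open>t'\<close>; as \<open>z\<close> is red, no letter of \<open>t'\<close> can precede it. So \<open>t'\<close> follows \<open>z\<close>, which follows
  \<open>s\<close>, and \<open>s\<close> lies below \<open>a\<close>; then \<open>s @ t' @ r\<close> is a forbidden copy.
\<close>
lemma avoider_splits:
  assumes w: "distinct w" and T: "[] \<notin> T" and av: "avoids_all (S \<oplus> T \<oplus> R) w"
  shows "\<exists>A. avoids_all (S \<oplus> T) (filter (\<lambda>x. x \<in> A) w) \<and> avoids_all (T \<oplus> R) (filter (\<lambda>x. x \<notin> A) w)"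
proof -
  obtain A where gA: "greedy_colouring S T w A"
    using greedy_colouring_exists[OF w T] by blast
  then have A: "avoids_all (S \<oplus> T) (filter (\<lambda>x. x \<in> A) w)"
    by (simp add: greedy_colouring_def)
  note blue = greedy_colouring_blue[OF gA] and red = greedy_colouring_red[OF gA]
  have no: False if "s \<in> S" "t \<in> T" "r \<in> R" "\<And>x y. x \<in> set s \<Longrightarrow> y \<in> set t \<Longrightarrow> x < y"
    "\<And>x y. x \<in> set t \<Longrightarrow> y \<in> set r \<Longrightarrow> x < y" "subseq (s @ t @ r) w" for s t r
  proof -
    have "t \<noteq> []" using that T by auto
    have "x < y" if "x \<in> set s" "y \<in> set r" for x y
      using that \<open>t \<noteq> []\<close> \<open>\<And>x y. x \<in> set s \<Longrightarrow> y \<in> set t \<Longrightarrow> x < y\<close> \<open>\<And>x y. x \<in> set t \<Longrightarrow> y \<in> set r \<Longrightarrow> x < y\<close>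
      by (meson last_in_set order.strict_trans)
    then have "s @ t @ r \<in> S \<oplus> T \<oplus> R"
      using that by (intro direct_sumI) auto
    then show False
      using av that by (auto simp: avoids_all_def)
  qed
  have "avoids_all (T \<oplus> R) (filter (\<lambda>x. x \<notin> A) w)"
    unfolding avoids_all_def
  proof (intro ballI notI)
    fix d assume "d \<in> T \<oplus> R" and dsub: "subseq d (filter (\<lambda>x. x \<notin> A) w)"
    then obtain t' r where d: "d = t' @ r" "t' \<in> T" "r \<in> R" "\<And>x y. x \<in> set t' \<Longrightarrow> y \<in> set r \<Longrightarrow> x < y"
      by (metis direct_sumE)
    have dw: "subseq (t' @ r) w"
      using dsub d(1) subseq_filter_left subseq_order.trans by blast
    have blue_d: "x \<notin> A" if "x \<in> set t' \<union> set r" for x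
      using list_emb_set[OF dsub, of x] that d(1) by auto
    have "t' \<noteq> []"
      using d T by auto
    define a where "a = Min (set t')"
    have a: "a \<in> set t'" "\<And>x. x \<in> set t' \<Longrightarrow> a \<le> x"
      using \<open>t' \<noteq> []\<close> by (auto simp: a_def)
    have "a \<in> set w"
      using subseq_subset[OF dw] a(1) by auto
    then obtain u v where uv: "w = u @ a # v"
      by (meson split_list)
    have "dominates_copy S T A u a"
      using blue[OF uv] blue_d a(1) by blast
    then obtain s t where st: "s \<in> S" "t \<in> T" "\<And>y z. y \<in> set s \<Longrightarrow> z \<in> set t \<Longrightarrow> y < z"
      "subseq (s @ t) (u @ [a])" "last t \<le> a" "set (butlast t) \<subseteq> A"
      unfolding dominates_copy_def by metis
    have "t \<noteq> []"
      using st T by auto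
    show False
    proof (cases "\<forall>z\<in>set (butlast t). \<forall>y\<in>set r. z < y")
      case True
      obtain b1 b2 where b: "t' = b1 @ a # b2"
        using a(1) by (meson split_list)
      have "subseq (b1 @ a # (b2 @ r)) (u @ a # v)"
        using dw b uv by simp
      then have "subseq (b2 @ r) v"
        by (rule subseq_split_at(2)) (use w uv in auto)
      then have "subseq r v"
        by (rule subseq_appendD)
      then have "subseq ((s @ t) @ r) ((u @ [a]) @ v)"
        by (rule list_emb_append_mono[OF st(4)])
      then have sub: "subseq (s @ t @ r) w"
        using uv by simp
      have "z < y" if "z \<in> set t" "y \<in> set r" for z y
      proof (cases "z \<in> set (butlast t)")
        case False
        then have "z = last t"
          using that(1) \<open>t \<noteq> []\<close> by (metis append_butlast_last_id Un_iff empty_iff empty_set insert_iff list.simps(15) set_append)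
        then show ?thesis
          using st(5) d(4)[OF a(1) that(2)] by simp
      qed (use True that in auto)
      then show False
        using no[OF st(1,2) d(3) st(3) _ sub] by blast
    next
      case False
      then obtain z c where z: "z \<in> set (butlast t)" "c \<in> set r" "c \<le> z"
        by (meson not_le_imp_less)
      have zA: "z \<in> A" and zt: "z \<in> set t"
        using z st(6) by (auto dest: in_set_butlastD)
      have above: "x < z" if "x \<in> set t'" for x
        using d(4)[OF that z(2)] z(3) by simp
      have stw: "subseq (s @ t) w"
      proof -
        have "subseq ((s @ t) @ []) ((u @ [a]) @ v)"
          by (rule list_emb_append_mono[OF st(4)]) simp
        then show ?thesis using uv by simp
      qed
      then have "z \<in> set w"
        using subseq_subset zt by fastforce
      then obtain u1 v1 where uv1: "w = u1 @ z # v1"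
        by (meson split_list)
      obtain t1 t2 where t12: "t = t1 @ z # t2"
        using zt by (meson split_list)
      have "subseq ((s @ t1) @ z # t2) (u1 @ z # v1)"
        using stw t12 uv1 by simp
      then have "subseq (s @ t1) u1"
        by (rule subseq_split_at(1)) (use w uv1 in auto)
      then have s: "subseq s u1"
        by (rule subseq_appendD)
      obtain h t'' where h: "t' = h # t''"
        using \<open>t' \<noteq> []\<close> by (cases t') auto
      have "h \<notin> set (u1 @ [z])"
        using red[OF uv1 zA, of h] above[of h] blue_d[of h] h by auto
      then have "subseq (t' @ r) v1"
        using subseq_skip_prefix[of h "t'' @ r" "u1 @ [z]" v1] dw h uv1 by simp
      then have "subseq (t' @ r) (z # v1)"
        by auto
      then have sub: "subseq (s @ t' @ r) w"
        using s uv1 by (auto intro: list_emb_append_mono)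
      have "x < y" if "x \<in> set s" "y \<in> set t'" for x y
        using st(3)[OF that(1), of "last t"] st(5) a(2)[OF that(2)] \<open>t \<noteq> []\<close> by simp
      then show False
        using no[OF st(1) d(2,3) _ d(4) sub] by blast
    qed
  qed
  then show ?thesis
    using A by blast
qed

section \<open>Schensted insertion and decreasing subsequences\<close>

text \<open>
  Decreasing subsequences of \<open>a\<close> can be traded for decreasing subsequences of \<open>b\<close> of the same length. The
  traded letters must stay within the range of the original ones, which makes the relation a
  congruence for concatenation and compatible with discarding large letters.
\<close>
definition dec_le :: "nat list \<Rightarrow> nat list \<Rightarrow> bool"  (infix "\<preceq>" 50) where
  "a \<preceq> b \<longleftrightarrow> (\<forall>d. subseq d a \<longrightarrow> sorted_wrt (>) d \<longrightarrow>
     (\<exists>e. subseq e b \<and> sorted_wrt (>) e \<and> length e = length d \<and>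
        (\<forall>x\<in>set e. (\<exists>y\<in>set d. x \<le> y) \<and> (\<exists>y\<in>set d. y \<le> x))))"

lemma dec_le_refl: "a \<preceq> a"
  unfolding dec_le_def by blast

lemma dec_le_trans:
  assumes "a \<preceq> b" "b \<preceq> c"
  shows "a \<preceq> c"
  unfolding dec_le_def
proof (intro allI impI)
  fix d assume "subseq d a" "sorted_wrt (>) d"
  then obtain e where e: "subseq e b" "sorted_wrt (>) e" "length e = length d"
    "\<forall>x\<in>set e. (\<exists>y\<in>set d. x \<le> y) \<and> (\<exists>y\<in>set d. y \<le> x)"
    using assms(1) unfolding dec_le_def by metis
  then obtain f where f: "subseq f c" "sorted_wrt (>) f" "length f = length e"
    "\<forall>x\<in>set f. (\<exists>y\<in>set e. x \<le> y) \<and> (\<exists>y\<in>set e. y \<le> x)"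
    using assms(2) unfolding dec_le_def by metis
  have "\<forall>x\<in>set f. (\<exists>y\<in>set d. x \<le> y) \<and> (\<exists>y\<in>set d. y \<le> x)"
    using e(4) f(4) by (meson order_trans)
  then show "\<exists>e. subseq e c \<and> sorted_wrt (>) e \<and> length e = length d \<and>
      (\<forall>x\<in>set e. (\<exists>y\<in>set d. x \<le> y) \<and> (\<exists>y\<in>set d. y \<le> x))"
    using f e(3) by (intro exI[of _ f]) simp
qed

lemma dec_le_append:
  assumes "a \<preceq> a'" "b \<preceq> b'"
  shows "a @ b \<preceq> a' @ b'"
  unfolding dec_le_def
proof (intro allI impI)
  fix d assume "subseq d (a @ b)" and dec: "sorted_wrt (>) d"
  then obtain d1 d2 where d: "d = d1 @ d2" "subseq d1 a" "subseq d2 b"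
    by (auto simp: subseq_append_iff)
  have d12: "sorted_wrt (>) d1" "sorted_wrt (>) d2" "\<forall>x\<in>set d1. \<forall>y\<in>set d2. y < x"
    using dec d(1) by (auto simp: sorted_wrt_append)
  obtain e1 where e1: "subseq e1 a'" "sorted_wrt (>) e1" "length e1 = length d1"
    "\<forall>x\<in>set e1. (\<exists>y\<in>set d1. x \<le> y) \<and> (\<exists>y\<in>set d1. y \<le> x)"
    using assms(1) d(2) d12(1) unfolding dec_le_def by metis
  obtain e2 where e2: "subseq e2 b'" "sorted_wrt (>) e2" "length e2 = length d2"
    "\<forall>x\<in>set e2. (\<exists>y\<in>set d2. x \<le> y) \<and> (\<exists>y\<in>set d2. y \<le> x)"
    using assms(2) d(3) d12(2) unfolding dec_le_def by metis
  have "\<forall>x\<in>set e1. \<forall>y\<in>set e2. y < x"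
    using e1(4) e2(4) d12(3) by (meson order.strict_trans1 order.strict_trans2)
  then have "sorted_wrt (>) (e1 @ e2)"
    using e1 e2 by (simp add: sorted_wrt_append)
  moreover have "subseq (e1 @ e2) (a' @ b')"
    by (rule list_emb_append_mono[OF e1(1) e2(1)])
  moreover have "\<forall>x\<in>set (e1 @ e2). (\<exists>y\<in>set d. x \<le> y) \<and> (\<exists>y\<in>set d. y \<le> x)"
    using e1(4) e2(4) d(1) by (metis Un_iff set_append)
  ultimately show "\<exists>e. subseq e (a' @ b') \<and> sorted_wrt (>) e \<and> length e = length d \<and>
      (\<forall>x\<in>set e. (\<exists>y\<in>set d. x \<le> y) \<and> (\<exists>y\<in>set d. y \<le> x))"
    using e1(3) e2(3) d(1) by (intro exI[of _ "e1 @ e2"]) simp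
qed

lemma dec_le_filter:
  assumes "a \<preceq> b" and down: "\<And>x y. x \<le> y \<Longrightarrow> P y \<Longrightarrow> P x"
  shows "filter P a \<preceq> filter P b"
  unfolding dec_le_def
proof (intro allI impI)
  fix d assume d: "subseq d (filter P a)" "sorted_wrt (>) d"
  then have "subseq d a"
    using subseq_filter_left subseq_order.trans by blast
  then obtain e where e: "subseq e b" "sorted_wrt (>) e" "length e = length d"
    "\<forall>x\<in>set e. (\<exists>y\<in>set d. x \<le> y) \<and> (\<exists>y\<in>set d. y \<le> x)"
    using assms(1) d(2) unfolding dec_le_def by metis
  have "\<forall>y\<in>set d. P y"
    using subseq_subset[OF d(1)] by auto
  then have "\<forall>x\<in>set e. P x"
    using e(4) down by blast
  then have "filter P e = e"
    by (simp add: filter_id_conv)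
  then have "subseq e (filter P b)"
    using subseq_filter[OF e(1), of P] by simp
  then show "\<exists>e. subseq e (filter P b) \<and> sorted_wrt (>) e \<and> length e = length d \<and>
      (\<forall>x\<in>set e. (\<exists>y\<in>set d. x \<le> y) \<and> (\<exists>y\<in>set d. y \<le> x))"
    using e by blast
qed

lemma decreasing_in_increasing:
  assumes "subseq d r" "sorted_wrt (>) d" "sorted_wrt (<) (r :: nat list)"
  shows "length d \<le> 1"
proof (rule ccontr)
  assume "\<not> length d \<le> 1"
  then obtain x y d' where d: "d = x # y # d'"
    by (cases d; cases "tl d") auto
  have "sorted_wrt (<) d"
    using assms(1,3) by (rule sorted_wrt_subseq)
  then show False
    using assms(2) d by simp
qed

text \<open>
  One row of Schensted insertion: \<open>v\<close> enters the row \<open>as @ w # bs\<close> and bumps \<open>w\<close> out of it. A row is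
  increasing, so a decreasing subsequence of the left-hand side uses at most \<open>w\<close> and one smaller letter of
  the new row; that letter is at most \<open>v\<close>, and the pair can be replaced by \<open>w\<close>, \<open>v\<close>.
\<close>
lemma dec_le_bump:
  assumes sorted: "sorted_wrt (<) (as @ w # bs)" and as: "\<forall>x\<in>set as. x < v" and v: "v < w"
  shows "w # as @ v # bs \<preceq> (as @ w # bs) @ [v]"
  unfolding dec_le_def
proof (intro allI impI)
  fix d assume "subseq d (w # as @ v # bs)" and dec: "sorted_wrt (>) d"
  then have "subseq d ([w] @ (as @ v # bs))"
    by simp
  then obtain d1 d2 where d: "d = d1 @ d2" "subseq d1 [w]" "subseq d2 (as @ v # bs)"
    by (metis subseq_append_iff)
  have row: "sorted_wrt (<) (as @ v # bs)"
    using sorted as v by (auto simp: sorted_wrt_append)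
  have "sorted_wrt (>) d2"
    using dec d(1) by (simp add: sorted_wrt_append)
  then have "length d2 \<le> 1"
    using decreasing_in_increasing[OF d(3) _ row] by blast
  moreover have "length d1 \<le> 1"
    using list_emb_length[OF d(2)] by simp
  moreover have d1w: "set d1 \<subseteq> {w}" and d2s: "set d2 \<subseteq> set as \<union> {v} \<union> set bs"
    using subseq_subset[OF d(2)] subseq_subset[OF d(3)] by auto
  ultimately consider "d = []" | "d = [w]" | u where "d = [u]" "u \<in> set as \<union> {v} \<union> set bs"
    | u where "d = [w, u]" "u \<in> set as \<union> {v} \<union> set bs"
    using d(1) by (cases d1; cases d2) auto
  then show "\<exists>e. subseq e ((as @ w # bs) @ [v]) \<and> sorted_wrt (>) e \<and> length e = length d \<and>
      (\<forall>x\<in>set e. (\<exists>y\<in>set d. x \<le> y) \<and> (\<exists>y\<in>set d. y \<le> x))"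
  proof cases
    case 1
    then show ?thesis by (intro exI[of _ "[]"]) auto
  next
    case 2
    then show ?thesis
      by (intro exI[of _ "[w]"]) (auto simp: subseq_singleton_left)
  next
    case (3 u)
    then show ?thesis
      by (intro exI[of _ "[u]"]) (auto simp: subseq_singleton_left)
  next
    case (4 u)
    have "u < w"
      using dec 4(1) by simp
    then have "u \<le> v"
      using 4(2) as sorted by (auto simp: sorted_wrt_append)
    have "subseq ([w] @ [v]) ((as @ w # bs) @ [v])"
      by (rule list_emb_append_mono) (auto simp: subseq_singleton_left)
    then show ?thesis
      using 4(1) v \<open>u \<le> v\<close> by (intro exI[of _ "[w, v]"]) auto
  qed
qed

text \<open>
  Schensted row insertion into a fixed number of rows, returning the index of the row that grew. The
  number of rows is kept constant by allowing empty rows, so that equal states are equal lists. If a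
  letter is pushed out of the last row it is lost, and the returned index is the number of rows.
\<close>
fun bump :: "nat \<Rightarrow> nat list list \<Rightarrow> nat list list \<times> nat" where
  "bump v [] = ([], 0)"
| "bump v (R # T) =
     (case dropWhile (\<lambda>x. x < v) R of
        [] \<Rightarrow> ((R @ [v]) # T, 0)
      | w # bs \<Rightarrow> (case bump w T of (T', c) \<Rightarrow> ((takeWhile (\<lambda>x. x < v) R @ v # bs) # T', Suc c)))"

lemma row_cases:
  fixes v :: nat
  assumes "sorted_wrt (<) R" "v \<notin> set R"
  obtains (ext) "\<And>T. bump v (R # T) = ((R @ [v]) # T, 0)" "\<forall>x\<in>set R. x < v"
  | (mid) as w bs where "R = as @ w # bs" "\<forall>x\<in>set as. x < v" "v < w"
      "\<And>T. bump v (R # T) = ((as @ v # bs) # fst (bump w T), Suc (snd (bump w T)))"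
proof (cases "dropWhile (\<lambda>x. x < v) R")
  case Nil
  have *: "bump v (R # T) = ((R @ [v]) # T, 0)" for T
    unfolding bump.simps Nil by simp
  show ?thesis
    by (rule ext[OF *]) (use Nil in \<open>auto simp: dropWhile_eq_Nil_conv\<close>)
next
  case (Cons w bs)
  have "\<not> w < v"
    using hd_dropWhile[of "\<lambda>x. x < v" R] Cons by simp
  moreover have R: "R = takeWhile (\<lambda>x. x < v) R @ w # bs"
    using Cons by (metis takeWhile_dropWhile_id)
  moreover have "w \<noteq> v"
    using R assms(2) by (metis in_set_conv_decomp)
  moreover have "bump v (R # T) =
      ((takeWhile (\<lambda>x. x < v) R @ v # bs) # fst (bump w T), Suc (snd (bump w T)))" for T
    unfolding bump.simps Cons by (simp split: prod.split)
  ultimately show ?thesis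
    by (intro mid[of "takeWhile (\<lambda>x. x < v) R" w bs]) (auto dest: set_takeWhileD)
qed

definition good_rows :: "nat list list \<Rightarrow> bool" where
  "good_rows T \<longleftrightarrow> (\<forall>R\<in>set T. sorted_wrt (<) R) \<and> distinct (concat T)"

lemma good_rows_Cons:
  "good_rows (R # T) \<longleftrightarrow> sorted_wrt (<) R \<and> good_rows T \<and> set R \<inter> set (concat T) = {}"
  by (auto simp: good_rows_def strict_sorted_iff)

lemma length_bump: "length (fst (bump v T)) = length T"
  by (induction v T rule: bump.induct) (auto split: list.split prod.split simp: prod_eq_iff)

lemma bump_code_le: "snd (bump v T) \<le> length T"
  by (induction v T rule: bump.induct) (auto split: list.splits prod.splits)

lemma set_bump:
  assumes "good_rows T" "v \<notin> set (concat T)" "snd (bump v T) < length T"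
  shows "set (concat (fst (bump v T))) = insert v (set (concat T))"
  using assms
proof (induction T arbitrary: v)
  case (Cons R T)
  have R: "sorted_wrt (<) R" "v \<notin> set R"
    using Cons.prems by (auto simp: good_rows_Cons)
  show ?case
  proof (cases rule: row_cases[OF R])
    case 1
    then show ?thesis by simp
  next
    case (2 as w bs)
    have "w \<notin> set (concat T)" "good_rows T"
      using Cons.prems 2(1) by (auto simp: good_rows_Cons)
    moreover have "snd (bump w T) < length T"
      using Cons.prems(3) 2(4) by simp
    ultimately have "set (concat (fst (bump w T))) = insert w (set (concat T))"
      using Cons.IH by blast
    then show ?thesis
      using 2(1,4) by auto
  qed
qed simp

lemma good_rows_bump:
  assumes "good_rows T" "v \<notin> set (concat T)" "snd (bump v T) < length T"
  shows "good_rows (fst (bump v T))"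
  using assms
proof (induction T arbitrary: v)
  case (Cons R T)
  have R: "sorted_wrt (<) R" "v \<notin> set R"
    using Cons.prems by (auto simp: good_rows_Cons)
  show ?case
  proof (cases rule: row_cases[OF R])
    case 1
    then show ?thesis
      using Cons.prems by (auto simp: good_rows_Cons sorted_wrt_append)
  next
    case (2 as w bs)
    have w: "w \<notin> set (concat T)" "good_rows T" "w \<notin> set as" "w \<notin> set bs"
      using Cons.prems 2(1) by (auto simp: good_rows_Cons sorted_wrt_append)
    moreover have lt: "snd (bump w T) < length T"
      using Cons.prems(3) 2(4) by simp
    ultimately have IH: "good_rows (fst (bump w T))"
      using Cons.IH by blast
    have set: "set (concat (fst (bump w T))) = insert w (set (concat T))"
      using set_bump w lt by blast
    have "sorted_wrt (<) (as @ v # bs)"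
      using R 2 by (auto simp: sorted_wrt_append)
    moreover have "set (as @ v # bs) \<inter> insert w (set (concat T)) = {}"
      using Cons.prems w 2(1,3) by (auto simp: good_rows_Cons)
    moreover have "fst (bump v (R # T)) = (as @ v # bs) # fst (bump w T)"
      using 2(4) by simp
    ultimately show ?thesis
      using IH set by (simp only: good_rows_Cons)
  qed
qed simp

text \<open>
  The letter added at the end of row \<open>c\<close> is the last one bumped. Going upwards, a letter \<open>w\<close> that was bumped
  from a row was replaced by the largest letter below \<open>w\<close> in the new row, and so the replacement
  can be located and undone.
\<close>
lemma bump_inj:
  assumes "good_rows T1" "v1 \<notin> set (concat T1)" "good_rows T2" "v2 \<notin> set (concat T2)"
    and "bump v1 T1 = (T', c)" "bump v2 T2 = (T', c)" "c < length T'"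
  shows "v1 = v2 \<and> T1 = T2"
  using assms
proof (induction T' arbitrary: T1 T2 v1 v2 c)
  case (Cons R' T')
  obtain R1 U1 where T1: "T1 = R1 # U1"
    using Cons.prems(5,7) by (cases T1) auto
  obtain R2 U2 where T2: "T2 = R2 # U2"
    using Cons.prems(6,7) by (cases T2) auto
  have R1: "sorted_wrt (<) R1" "v1 \<notin> set R1" and R2: "sorted_wrt (<) R2" "v2 \<notin> set R2"
    using Cons.prems T1 T2 by (auto simp: good_rows_Cons)
  show ?case
  proof (cases rule: row_cases[OF R1])
    case 1
    then have "c = 0" "R' = R1 @ [v1]" "T' = U1"
      using Cons.prems T1 by auto
    then have "R' = R2 @ [v2]" "T' = U2"
      using Cons.prems(6) T2 by (cases rule: row_cases[OF R2]; simp)+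
    then show ?thesis
      using \<open>R' = R1 @ [v1]\<close> \<open>T' = U1\<close> T1 T2 by simp
  next
    case m1: (2 as1 w1 bs1)
    then obtain c' where c': "c = Suc c'" "bump w1 U1 = (T', c')" "R' = as1 @ v1 # bs1"
      using Cons.prems(5) T1 by (cases "bump w1 U1") auto
    show ?thesis
    proof (cases rule: row_cases[OF R2])
      case 1
      then show ?thesis
        using Cons.prems(6) c' T2 by simp
    next
      case m2: (2 as2 w2 bs2)
      then have r2: "bump w2 U2 = (T', c')" "R' = as2 @ v2 # bs2"
        using Cons.prems(6) T2 c'(1) by (cases "bump w2 U2"; auto)+
      have "w1 = w2 \<and> U1 = U2"
      proof (rule Cons.IH[OF _ _ _ _ c'(2) r2(1)])
        show "good_rows U1" "w1 \<notin> set (concat U1)" "good_rows U2" "w2 \<notin> set (concat U2)"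
          using Cons.prems(1,3) T1 T2 m1(1) m2(1) by (auto simp: good_rows_Cons)
        show "c' < length T'"
          using Cons.prems(7) c'(1) by simp
      qed
      then have w: "w1 = w2" "U1 = U2"
        by auto
      have t1: "as1 @ [v1] = takeWhile (\<lambda>x. x < w1) R'" and t2: "as2 @ [v2] = takeWhile (\<lambda>x. x < w2) R'"
      proof -
        have "\<forall>x\<in>set as1. x < w1" "\<forall>x\<in>set bs1. \<not> x < w1"
          using R1(1) m1(1) by (auto simp: sorted_wrt_append)
        then show "as1 @ [v1] = takeWhile (\<lambda>x. x < w1) R'"
          unfolding c'(3) using m1(3) by (cases bs1) (auto simp: takeWhile_append)
        have "\<forall>x\<in>set as2. x < w2" "\<forall>x\<in>set bs2. \<not> x < w2"
          using R2(1) m2(1) by (auto simp: sorted_wrt_append)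
        then show "as2 @ [v2] = takeWhile (\<lambda>x. x < w2) R'"
          unfolding r2(2) using m2(3) by (cases bs2) (auto simp: takeWhile_append)
      qed
      then have "as1 @ [v1] = as2 @ [v2]"
        unfolding w(1) by (rule trans[OF _ sym])
      then have eq: "as1 = as2" "v1 = v2"
        by simp_all
      then have "bs1 = bs2"
        using c'(3) r2(2) by simp
      then show ?thesis
        using eq w T1 T2 m1(1) m2(1) by simp
    qed
  qed
qed simp

text \<open>
  Reading the rows from the last to the first, insertion creates no new decreasing subsequences:
  this is half of Knuth's theorem that the insertion tableau is equivalent to the inserted word.
\<close>
lemma dec_le_bump_reading:
  assumes "good_rows T" "v \<notin> set (concat T)"
  shows "concat (rev (fst (bump v T))) \<preceq> concat (rev T) @ [v]"
  using assms
proof (induction T arbitrary: v)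
  case Nil
  then show ?case
    by (auto simp: dec_le_def)
next
  case (Cons R T)
  have R: "sorted_wrt (<) R" "v \<notin> set R"
    using Cons.prems by (auto simp: good_rows_Cons)
  show ?case
  proof (cases rule: row_cases[OF R])
    case 1
    then show ?thesis by (simp add: dec_le_refl)
  next
    case (2 as w bs)
    have "w \<notin> set (concat T)" "good_rows T"
      using Cons.prems 2(1) by (auto simp: good_rows_Cons)
    then have "concat (rev (fst (bump w T))) \<preceq> concat (rev T) @ [w]"
      using Cons.IH by blast
    then have "concat (rev (fst (bump w T))) @ (as @ v # bs) \<preceq> (concat (rev T) @ [w]) @ (as @ v # bs)"
      by (intro dec_le_append dec_le_refl)
    moreover have "concat (rev T) @ (w # as @ v # bs) \<preceq> concat (rev T) @ ((as @ w # bs) @ [v])"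
      using R(1) 2 by (intro dec_le_append dec_le_refl dec_le_bump) auto
    ultimately show ?thesis
      using 2(1,4) by (auto intro: dec_le_trans)
  qed
qed

text \<open>
  The letters bumped on the way down increase, and they are read in the opposite order.
\<close>
lemma overflow_decreasing:
  assumes "good_rows T" "v \<notin> set (concat T)" "snd (bump v T) = length T"
  shows "\<exists>d. subseq (d @ [v]) (concat (rev T) @ [v]) \<and> sorted_wrt (>) (d @ [v]) \<and> length d = length T"
  using assms
proof (induction T arbitrary: v)
  case Nil
  then show ?case by (intro exI[of _ "[]"]) simp
next
  case (Cons R T)
  have R: "sorted_wrt (<) R" "v \<notin> set R"
    using Cons.prems by (auto simp: good_rows_Cons)
  show ?case
  proof (cases rule: row_cases[OF R])
    case 1
    then show ?thesis
      using Cons.prems by simp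
  next
    case (2 as w bs)
    have "w \<notin> set (concat T)" "good_rows T" "snd (bump w T) = length T"
      using Cons.prems 2(1,4) by (auto simp: good_rows_Cons)
    then obtain d where d: "subseq (d @ [w]) (concat (rev T) @ [w])" "sorted_wrt (>) (d @ [w])" "length d = length T"
      using Cons.IH by blast
    have "subseq d (concat (rev T))"
      using d(1) by simp
    moreover have "subseq [w] R"
      using 2(1) by (simp add: subseq_singleton_left)
    ultimately have "subseq ((d @ [w]) @ [v]) ((concat (rev T) @ R) @ [v])"
      by (intro list_emb_append_mono) auto
    moreover have "sorted_wrt (>) ((d @ [w]) @ [v])"
      using d(2) 2(3) by (auto simp: sorted_wrt_append)
    ultimately show ?thesis
      using d(3) by (intro exI[of _ "d @ [w]"]) simp
  qed
qed

section \<open>Coding the avoiders of a decreasing layer followed by a larger letter\<close>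

text \<open>
  Here \<open>s\<close> is the part of the word that has not been read. A letter already read matters only while it is
  below some letter of \<open>s\<close>, as only then can it belong to a decreasing word below a later letter.
\<close>
definition below :: "nat list \<Rightarrow> nat \<Rightarrow> bool" where
  "below s x \<longleftrightarrow> (\<exists>y\<in>set s. x < y)"

text \<open>
  If \<open>x\<close> exceeds all of \<open>s\<close>, then reading it lowers the maximum of the unread letters, and the letters
  above the new maximum, \<open>x\<close> among them, are discarded. Otherwise the maximum is unchanged.
\<close>
definition advance :: "nat \<Rightarrow> nat list \<Rightarrow> nat list list \<Rightarrow> nat list list" where
  "advance x s T = (if below s x then fst (bump x T) else map (filter (below s)) T)"

text \<open>
  The state \<open>T\<close> of \<open>m\<close> rows after reading \<open>u\<close>, with \<open>s\<close> unread. The last conjunct is what bounds the number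
  of rows: decreasing subsequences found among the rows are present in the word itself.
\<close>
definition rows_inv :: "nat \<Rightarrow> nat list \<Rightarrow> nat list \<Rightarrow> nat list list \<Rightarrow> bool" where
  "rows_inv m u s T \<longleftrightarrow> length T = m \<and> good_rows T \<and> set (concat T) = {z \<in> set u. below s z} \<and>
     concat (rev T) \<preceq> filter (below s) u"

lemma below_mono: "x \<le> y \<Longrightarrow> below s y \<Longrightarrow> below s x"
  unfolding below_def by (meson order.strict_trans1)

lemma below_Cons_iff: "below (x # s) z \<longleftrightarrow> z < x \<or> below s z"
  by (auto simp: below_def)

text \<open>
  A letter pushed out of the last of \<open>m\<close> rows would exhibit a decreasing subsequence of length
  \<open>m + 1\<close> below the largest unread letter, which completes it to a forbidden copy.
\<close>
lemma no_overflow: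
  assumes inv: "rows_inv m u (x # s) T" and dist: "distinct (u @ x # s)"
    and av: "avoids_all (decreasing_words (Suc m) \<oplus> decreasing_words 1) (u @ x # s)"
    and x: "below s x"
  shows "snd (bump x T) < m"
proof (rule ccontr)
  have T: "length T = m" "good_rows T" "concat (rev T) \<preceq> filter (below (x # s)) u" "x \<notin> set (concat T)"
    using inv dist by (auto simp: rows_inv_def)
  assume "\<not> snd (bump x T) < m"
  then have "snd (bump x T) = length T"
    using bump_code_le[of x T] T(1) by simp
  then obtain d where d: "subseq (d @ [x]) (concat (rev T) @ [x])" "sorted_wrt (>) (d @ [x])" "length d = m"
    using overflow_decreasing T by metis
  have "concat (rev T) @ [x] \<preceq> filter (below (x # s)) u @ [x]"
    using T(3) by (intro dec_le_append dec_le_refl)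
  then obtain e where e: "subseq e (filter (below (x # s)) u @ [x])" "sorted_wrt (>) e" "length e = Suc m"
    using d unfolding dec_le_def by (metis length_append_singleton)
  obtain y where y: "y \<in> set s" "x < y" "\<And>z. z \<in> set s \<Longrightarrow> z \<le> y"
  proof -
    obtain z where z: "z \<in> set s" "x < z"
      using x by (auto simp: below_def)
    then have "Max (set s) \<in> set s"
      by (intro Max_in) auto
    moreover have "x < Max (set s)"
      using z(2) Max_ge[OF _ z(1)] by simp
    ultimately show thesis using that by simp
  qed
  have "z < y" if "z \<in> set e" for z
    using subseq_subset[OF e(1)] that y by (force simp: below_def)
  then have "e @ [y] \<in> decreasing_words (Suc m) \<oplus> decreasing_words 1"
    using e by (intro direct_sumI) (auto simp: decreasing_words_def)
  moreover have "subseq (e @ [y]) (u @ x # s)"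
  proof -
    have "subseq (filter (below (x # s)) u @ [x]) (u @ [x])"
      by (intro list_emb_append_mono) auto
    then have "subseq e (u @ [x])"
      using e(1) by (rule subseq_order.trans[rotated])
    then have "subseq (e @ [y]) ((u @ [x]) @ s)"
      using y(1) by (intro list_emb_append_mono) (auto simp: subseq_singleton_left)
    then show ?thesis by simp
  qed
  ultimately show False
    using av by (auto simp: avoids_all_def)
qed

lemma concat_map_filter: "concat (map (filter P) T) = filter P (concat T)"
  by (induction T) auto

lemma good_rows_filter: "good_rows T \<Longrightarrow> good_rows (map (filter P) T)"
  by (auto simp: good_rows_def concat_map_filter sorted_wrt_filter)

lemma rows_inv_advance:
  assumes inv: "rows_inv m u (x # s) T" and dist: "distinct (u @ x # s)"
    and av: "avoids_all (decreasing_words (Suc m) \<oplus> decreasing_words 1) (u @ x # s)"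
  shows "rows_inv m (u @ [x]) s (advance x s T)"
proof (cases "below s x")
  case True
  have T: "length T = m" "good_rows T" "concat (rev T) \<preceq> filter (below (x # s)) u" "x \<notin> set (concat T)"
    "set (concat T) = {z \<in> set u. below (x # s) z}"
    using inv dist by (auto simp: rows_inv_def)
  have lt: "snd (bump x T) < length T"
    using no_overflow[OF assms True] T(1) by simp
  have same: "below (x # s) = below s"
    using True by (auto simp: below_def fun_eq_iff dest: order.strict_trans)
  have "concat (rev (fst (bump x T))) \<preceq> concat (rev T) @ [x]"
    using dec_le_bump_reading T by blast
  also have "concat (rev T) @ [x] \<preceq> filter (below s) u @ [x]"
    using T(3) same by (intro dec_le_append dec_le_refl) simp
  finally (dec_le_trans) have "concat (rev (fst (bump x T))) \<preceq> filter (below s) (u @ [x])"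
    using True by simp
  then show ?thesis
    using True T good_rows_bump[OF T(2,4) lt] set_bump[OF T(2,4) lt] same
    by (auto simp: rows_inv_def advance_def length_bump)
next
  case False
  have filt: "filter (below s) (filter (below (x # s)) u) = filter (below s) (u @ [x])"
    using False by (auto simp: below_Cons_iff intro!: filter_cong)
  have "filter (below s) (concat (rev T)) \<preceq> filter (below s) (filter (below (x # s)) u)"
    using inv below_mono by (intro dec_le_filter) (auto simp: rows_inv_def)
  then have "concat (rev (map (filter (below s)) T)) \<preceq> filter (below s) (u @ [x])"
    unfolding filt by (simp add: rev_map concat_map_filter)
  moreover have "set (concat (map (filter (below s)) T)) = {z \<in> set (u @ [x]). below s z}"
    unfolding concat_map_filter using inv False by (auto simp: rows_inv_def below_Cons_iff)
  ultimately show ?thesis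
    using inv False unfolding rows_inv_def advance_def by (simp add: good_rows_filter)
qed

fun row_index :: "nat list list \<Rightarrow> nat \<Rightarrow> nat" where
  "row_index [] z = 0"
| "row_index (R # T) z = (if z \<in> set R then 0 else Suc (row_index T z))"

lemma row_index_less: "z \<in> set (concat T) \<Longrightarrow> row_index T z < length T \<and> z \<in> set (T ! row_index T z)"
  by (induction T) auto

lemma row_index_unique: "good_rows T \<Longrightarrow> i < length T \<Longrightarrow> z \<in> set (T ! i) \<Longrightarrow> row_index T z = i"
proof (induction T arbitrary: i)
  case (Cons R T)
  then show ?case
    by (cases i) (auto simp: good_rows_Cons, blast dest: nth_mem)
qed simp

text \<open>
  The colour \<open>length T\<close> is not a row index; in both colourings it marks the right-to-left maxima.
\<close>
fun position_colour :: "nat list list \<Rightarrow> nat list \<Rightarrow> nat \<Rightarrow> nat" where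
  "position_colour T [] x = 0"
| "position_colour T (y # s) x =
     (if x = y then (if below s y then snd (bump y T) else length T)
      else position_colour (advance y s T) s x)"

fun value_colour :: "nat list list \<Rightarrow> nat list \<Rightarrow> nat \<Rightarrow> nat" where
  "value_colour T [] z = 0"
| "value_colour T (y # s) z =
     (if below s y then value_colour (advance y s T) s z
      else if z = y then length T
      else if z \<in> set (concat T) \<and> \<not> below s z then row_index T z
      else value_colour (advance y s T) s z)"

lemma position_colour_le:
  "length T = m \<Longrightarrow> position_colour T s x \<le> m"
proof (induction s arbitrary: T)
  case (Cons y s)
  have "length (advance y s T) = m"
    using Cons.prems by (simp add: advance_def length_bump)
  then show ?case
    using Cons bump_code_le[of y T] by auto
qed simp

lemma value_colour_le:
  "length T = m \<Longrightarrow> value_colour T s z \<le> m"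
proof (induction s arbitrary: T)
  case (Cons y s)
  have "length (advance y s T) = m"
    using Cons.prems by (simp add: advance_def length_bump)
  moreover have "row_index T z \<le> m" if "z \<in> set (concat T)"
    using row_index_less[OF that] Cons.prems by simp
  ultimately show ?case
    using Cons by auto
qed simp

lemma map_position_colour_Cons:
  assumes "distinct (x # s)"
  shows "map (position_colour T (x # s)) (x # s) =
    (if below s x then snd (bump x T) else length T) # map (position_colour (advance x s T) s) s"
  using assms by auto

text \<open>
  Decoding runs from right to left, hence the induction on the unread suffix; \<open>g\<close> is the common value
  colouring. If the current letter was inserted, the insertion is undone by its position colour. If it is a
  right-to-left maximum, its value is the least special one above the suffix: a smaller special
  candidate would have been among the discarded letters in the other word, and those carry row
  indices as value colours. The discarded letters are the remaining ones between the suffix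
  maximum and the current letter, and their value colours put them back into their rows.
\<close>
lemma decode:
  assumes "length s1 = length s2"
    and "rows_inv m u1 s1 T1" "rows_inv m u2 s2 T2"
    and "distinct (u1 @ s1)" "distinct (u2 @ s2)" "set (u1 @ s1) = set (u2 @ s2)"
    and "avoids_all (decreasing_words (Suc m) \<oplus> decreasing_words 1) (u1 @ s1)"
    and "avoids_all (decreasing_words (Suc m) \<oplus> decreasing_words 1) (u2 @ s2)"
    and "map (position_colour T1 s1) s1 = map (position_colour T2 s2) s2"
    and "\<And>z. z \<in> set (concat T1) \<union> set s1 \<Longrightarrow> value_colour T1 s1 z = g z"
    and "\<And>z. z \<in> set (concat T2) \<union> set s2 \<Longrightarrow> value_colour T2 s2 z = g z"
  shows "s1 = s2 \<and> T1 = T2"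
  using assms
proof (induction s1 s2 arbitrary: u1 u2 T1 T2 rule: list_induct2)
  case Nil
  then have "set (concat T1) = {}" "set (concat T2) = {}" "length T1 = m" "length T2 = m"
    by (auto simp: rows_inv_def below_def)
  then have "T1 = replicate m []" "T2 = replicate m []"
    by (auto intro!: replicate_eqI)
  then show ?case by simp
next
  case (Cons x1 s1 x2 s2)
  note inv1 = Cons.prems(1) and inv2 = Cons.prems(2)
  note dist1 = Cons.prems(3) and dist2 = Cons.prems(4)
  have T1: "length T1 = m" "good_rows T1" "set (concat T1) = {z \<in> set u1. below (x1 # s1) z}"
    and T2: "length T2 = m" "good_rows T2" "set (concat T2) = {z \<in> set u2. below (x2 # s2) z}"
    using inv1 inv2 by (auto simp: rows_inv_def)
  have val: "value_colour (advance x s T) s z = g z"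
    if inv: "rows_inv m u (x # s) T" and dist: "distinct (u @ x # s)"
      and av: "avoids_all (decreasing_words (Suc m) \<oplus> decreasing_words 1) (u @ x # s)"
      and g: "\<And>z. z \<in> set (concat T) \<union> set (x # s) \<Longrightarrow> value_colour T (x # s) z = g z"
      and z: "z \<in> set (concat (advance x s T)) \<union> set s" for u x s T z
  proof -
    have T: "set (concat T) = {z \<in> set u. below (x # s) z}"
      using inv by (auto simp: rows_inv_def)
    have T': "set (concat (advance x s T)) = {z \<in> set (u @ [x]). below s z}"
      using rows_inv_advance[OF inv dist av] by (auto simp: rows_inv_def)
    have mem: "z \<in> set (concat T) \<union> set (x # s)"
      using z T T' by (auto simp: below_Cons_iff)
    show ?thesis
    proof (cases "below s x")
      case True
      then show ?thesis
        using g[OF mem] by simp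
    next
      case False
      then have "z \<noteq> x" "\<not> (z \<in> set (concat T) \<and> \<not> below s z)"
        using z dist unfolding T T' by auto
      then show ?thesis
        using g[OF mem] False by auto
    qed
  qed
  have pos: "(if below s1 x1 then snd (bump x1 T1) else m) = (if below s2 x2 then snd (bump x2 T2) else m)"
    "map (position_colour (advance x1 s1 T1) s1) s1 = map (position_colour (advance x2 s2 T2) s2) s2"
  proof -
    have d: "distinct (x1 # s1)" "distinct (x2 # s2)"
      using dist1 dist2 by auto
    show "(if below s1 x1 then snd (bump x1 T1) else m) = (if below s2 x2 then snd (bump x2 T2) else m)"
      "map (position_colour (advance x1 s1 T1) s1) s1 = map (position_colour (advance x2 s2 T2) s2) s2"
      using Cons.prems(8)
      unfolding map_position_colour_Cons[OF d(1)] map_position_colour_Cons[OF d(2)] T1(1) T2(1)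
      by (simp_all only: list.inject)
  qed
  have "s1 = s2 \<and> advance x1 s1 T1 = advance x2 s2 T2"
  proof (rule Cons.IH[OF rows_inv_advance[OF inv1 dist1 Cons.prems(6)] rows_inv_advance[OF inv2 dist2 Cons.prems(7)]])
    show "distinct ((u1 @ [x1]) @ s1)" "distinct ((u2 @ [x2]) @ s2)"
      "set ((u1 @ [x1]) @ s1) = set ((u2 @ [x2]) @ s2)"
      using dist1 dist2 Cons.prems(5) by auto
    show "avoids_all (decreasing_words (Suc m) \<oplus> decreasing_words 1) ((u1 @ [x1]) @ s1)"
      "avoids_all (decreasing_words (Suc m) \<oplus> decreasing_words 1) ((u2 @ [x2]) @ s2)"
      using Cons.prems(6,7) by auto
    show "map (position_colour (advance x1 s1 T1) s1) s1 = map (position_colour (advance x2 s2 T2) s2) s2"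
      by (rule pos(2))
    show "value_colour (advance x1 s1 T1) s1 z = g z" if "z \<in> set (concat (advance x1 s1 T1)) \<union> set s1" for z
      by (rule val[OF inv1 dist1 Cons.prems(6,9) that])
    show "value_colour (advance x2 s2 T2) s2 z = g z" if "z \<in> set (concat (advance x2 s2 T2)) \<union> set s2" for z
      by (rule val[OF inv2 dist2 Cons.prems(7,10) that])
  qed
  then have s: "s1 = s2" and adv: "advance x1 s1 T1 = advance x2 s2 T2"
    by auto
  have lt1: "below s1 x1 \<Longrightarrow> snd (bump x1 T1) < m" and lt2: "below s2 x2 \<Longrightarrow> snd (bump x2 T2) < m"
    using no_overflow[OF inv1 dist1 Cons.prems(6)] no_overflow[OF inv2 dist2 Cons.prems(7)] by auto
  show ?case
  proof (cases "below s1 x1")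
    case True
    then have b2: "below s2 x2"
      using pos(1) lt1 by (auto split: if_splits)
    have "x1 = x2 \<and> T1 = T2"
    proof (rule bump_inj[OF T1(2) _ T2(2)])
      show "x1 \<notin> set (concat T1)" "x2 \<notin> set (concat T2)"
        unfolding T1 T2 using dist1 dist2 by auto
      show "bump x1 T1 = (fst (bump x1 T1), snd (bump x1 T1))"
        by simp
      show "bump x2 T2 = (fst (bump x1 T1), snd (bump x1 T1))"
        using adv pos(1) True b2 by (simp add: advance_def prod_eq_iff)
      show "snd (bump x1 T1) < length (fst (bump x1 T1))"
        using lt1[OF True] T1(1) by (simp add: length_bump)
    qed
    then show ?thesis
      using s by simp
  next
    case False
    then have b2: "\<not> below s2 x2"
      using pos(1) lt2 by (auto split: if_splits)
    \<comment> \<open>stated for both words at once, as it is applied with their roles exchanged\<close>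
    have not_less: "\<not> x < x'"
      if sb: "\<not> below s x" "\<not> below s x'" and T: "set (concat T') = {z \<in> set u'. below (x' # s) z}" "length T' = m"
        and gx: "g x = m" and g': "\<And>z. z \<in> set (concat T') \<union> set (x' # s) \<Longrightarrow> value_colour T' (x' # s) z = g z"
        and mem: "x \<in> set (u' @ x' # s)" "x \<notin> set s" for x x' s u' T'
    proof
      assume "x < x'"
      then have x: "x \<in> set (concat T')"
        unfolding T using mem by (auto simp: below_Cons_iff)
      then have "g x = row_index T' x"
        using g'[of x] sb \<open>x < x'\<close> by auto
      then show False
        using row_index_less[OF x] T(2) gx by simp
    qed
    have gm: "g x1 = m" "g x2 = m"
      using Cons.prems(9)[of x1] Cons.prems(10)[of x2] False b2 T1(1) T2(1) by auto
    have "\<not> x1 < x2"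
      by (rule not_less[OF _ b2 T2(3,1) gm(1) Cons.prems(10)]) (use False s Cons.prems(5) dist1 in auto)
    moreover have "\<not> x2 < x1"
      by (rule not_less[OF _ False T1(3,1) gm(2) Cons.prems(9)]) (use b2 s Cons.prems(5) dist2 in auto)
    ultimately have x: "x1 = x2"
      by simp
    have u: "set u1 = set u2"
      using Cons.prems(5) dist1 dist2 x s by auto
    have sub: "set (T ! i) \<subseteq> set (T' ! i)"
      if "good_rows T" "good_rows T'" "length T = m" "length T' = m" "i < m"
        and eq: "map (filter (below s1)) T = map (filter (below s1)) T'"
        and sets: "set (concat T) = set (concat T')"
        and g: "\<And>z. z \<in> set (concat T) \<Longrightarrow> value_colour T (x1 # s1) z = g z"
        and g': "\<And>z. z \<in> set (concat T') \<Longrightarrow> value_colour T' (x1 # s1) z = g z"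
        and nx: "x1 \<notin> set (concat T)"
      for T T' i
    proof
      fix z assume z: "z \<in> set (T ! i)"
      have zT: "z \<in> set (concat T)"
        using z that(3,5) by auto
      show "z \<in> set (T' ! i)"
      proof (cases "below s1 z")
        case True
        have "z \<in> set (filter (below s1) (T ! i))"
          using z True by simp
        also have "filter (below s1) (T ! i) = filter (below s1) (T' ! i)"
          using eq that(3,4,5) by (metis nth_map)
        finally show ?thesis
          by simp
      next
        case nb: False
        have "z \<noteq> x1"
          using zT nx by auto
        have zT': "z \<in> set (concat T')"
          using zT unfolding sets .
        then have "g z = row_index T z" "g z = row_index T' z"
          using g[OF zT] g'[OF zT'] \<open>z \<noteq> x1\<close> zT zT' nb False by (simp_all del: set_concat)
        moreover have "row_index T z = i"
          using row_index_unique that(1,3,5) z by blast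
        ultimately show ?thesis
          using row_index_less[OF zT'] by simp
      qed
    qed
    have sets: "set (concat T1) = set (concat T2)"
      unfolding T1 T2 using u x s by simp
    have eq: "map (filter (below s1)) T1 = map (filter (below s1)) T2"
      using adv False b2 s by (simp add: advance_def)
    have nx: "x1 \<notin> set (concat T1)" "x1 \<notin> set (concat T2)"
      unfolding sets[symmetric] unfolding T1 using dist1 by auto
    have "T1 = T2"
    proof (rule nth_equalityI)
      show "length T1 = length T2"
        using T1 T2 by simp
      fix i assume "i < length T1"
      then have i: "i < m" using T1 by simp
      have "set (T1 ! i) = set (T2 ! i)"
      proof (rule equalityI)
        show "set (T1 ! i) \<subseteq> set (T2 ! i)"
          by (rule sub[OF T1(2) T2(2) T1(1) T2(1) i eq sets _ _ nx(1)])
            (use Cons.prems(9,10) s x in auto)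
        show "set (T2 ! i) \<subseteq> set (T1 ! i)"
          by (rule sub[OF T2(2) T1(2) T2(1) T1(1) i eq[symmetric] sets[symmetric] _ _ nx(2)])
            (use Cons.prems(9,10) s x in auto)
      qed
      moreover have "sorted_wrt (<) (T1 ! i)" "sorted_wrt (<) (T2 ! i)"
        using T1 T2 i by (auto simp: good_rows_def)
      ultimately show "T1 ! i = T2 ! i"
        by (metis strict_sorted_equal)
    qed
    then show ?thesis
      using x s by simp
  qed
qed

lemma codable_decreasing_one:
  "codable (Suc m) (avoids_all (decreasing_words (Suc m) \<oplus> decreasing_words 1))"
  unfolding codable_def
proof (rule exI[of _ "position_colour (replicate m [])"], rule exI[of _ "value_colour (replicate m [])"],
    intro conjI allI impI)
  let ?T = "replicate m ([] :: nat list)"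
  fix w x :: "nat list" and z :: nat
  show "position_colour ?T w z < Suc m" "value_colour ?T w z < Suc m"
    using position_colour_le[of ?T m] value_colour_le[of ?T m] by (simp_all add: less_Suc_eq_le)
next
  let ?T = "replicate m ([] :: nat list)"
  fix w w' :: "nat list"
  assume w: "avoids_all (decreasing_words (Suc m) \<oplus> decreasing_words 1) w" "distinct w"
    and w': "avoids_all (decreasing_words (Suc m) \<oplus> decreasing_words 1) w'" "distinct w'"
    and eq: "set w = set w'" "map (position_colour ?T w) w = map (position_colour ?T w') w'"
      "\<forall>x\<in>set w. value_colour ?T w x = value_colour ?T w' x"
  have "concat ?T = []"
    by simp
  then have inv: "rows_inv m [] s ?T" for s
    by (auto simp: rows_inv_def good_rows_def dec_le_refl)
  have "length w = length w'"
    using eq(2) by (metis length_map)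
  then have "w = w' \<and> ?T = ?T"
    by (rule decode[OF _ inv inv]) (use w w' eq in auto)
  then show "w = w'" by simp
qed

section \<open>Reversal and complementation\<close>

definition reverse_complement :: "nat list \<Rightarrow> nat list" where
  "reverse_complement w = rev (map (\<lambda>x. Max (set w) - x) w)"

text \<open>
  Complementing with respect to the largest letter keeps words over the same letters comparable, as
  they are complemented in the same way.
\<close>
lemma codable_one_decreasing:
  "codable (Suc m) (avoids_all (decreasing_words 1 \<oplus> decreasing_words (Suc m)))"
proof -
  let ?P = "avoids_all (decreasing_words (Suc m) \<oplus> decreasing_words 1)"
  let ?Q = "avoids_all (decreasing_words 1 \<oplus> decreasing_words (Suc m))"
  let ?rc = reverse_complement
  let ?N = "\<lambda>w :: nat list. Max (set w)"
  obtain p q where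
    r: "\<And>w x. ?P w \<Longrightarrow> distinct w \<Longrightarrow> x \<in> set w \<Longrightarrow> p w x < Suc m \<and> q w x < Suc m" and
    u: "\<And>w w'. ?P w \<Longrightarrow> ?P w' \<Longrightarrow> distinct w \<Longrightarrow> distinct w' \<Longrightarrow> set w = set w' \<Longrightarrow>
          map (p w) w = map (p w') w' \<Longrightarrow> \<forall>x\<in>set w. q w x = q w' x \<Longrightarrow> w = w'"
    using codable_decreasing_one[of m] unfolding codable_def by blast
  have le: "x \<le> ?N w" if "x \<in> set w" for x w
    using that by simp
  have set_rc: "set (?rc w) = (\<lambda>x. ?N w - x) ` set w" for w
    by (simp add: reverse_complement_def)
  have inverse: "rev (map (\<lambda>x. ?N w - x) (?rc w)) = w" for w
    by (auto simp: reverse_complement_def rev_map comp_def intro!: map_idI)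
  have dist: "distinct (?rc w)" if "distinct w" for w
    using that by (auto simp: reverse_complement_def distinct_map inj_on_def dest!: le)
  have Q_P: "?P (?rc w)" if Q: "?Q w" for w
    unfolding avoids_all_def
  proof (intro ballI notI)
    fix e assume "e \<in> decreasing_words (Suc m) \<oplus> decreasing_words 1" and sub: "subseq e (?rc w)"
    then obtain d f where e: "e = d @ f" "length d = Suc m" "sorted_wrt (>) d" "length f = 1"
      "\<And>x y. x \<in> set d \<Longrightarrow> y \<in> set f \<Longrightarrow> x < y"
      by (auto simp: decreasing_words_def elim!: direct_sumE)
    let ?c = "\<lambda>x. ?N w - x"
    have small: "x \<le> ?N w" if "x \<in> set e" for x
      using subseq_subset[OF sub] that by (auto simp: set_rc)
    have "subseq (rev (map ?c e)) (rev (map ?c (?rc w)))"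
      by (intro subseq_rev subseq_map sub)
    then have "subseq (rev (map ?c f) @ rev (map ?c d)) w"
      unfolding inverse using e(1) by simp
    moreover have "rev (map ?c f) @ rev (map ?c d) \<in> decreasing_words 1 \<oplus> decreasing_words (Suc m)"
    proof (rule direct_sumI)
      show "rev (map ?c f) \<in> decreasing_words 1"
        using e(4) by (cases f) (auto simp: decreasing_words_def)
      have "sorted_wrt (\<lambda>x y. ?c x < ?c y) d"
        by (rule sorted_wrt_mono_rel[OF _ e(3)]) (use small e(1) in \<open>auto intro!: diff_less_mono2 dest: order.strict_trans2\<close>)
      then show "rev (map ?c d) \<in> decreasing_words (Suc m)"
        using e(2) by (simp add: decreasing_words_def sorted_wrt_rev sorted_wrt_map)
      show "x < y" if "x \<in> set (rev (map ?c f))" "y \<in> set (rev (map ?c d))" for x y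
      proof -
        obtain x' y' where "x = ?c x'" "y = ?c y'" "x' \<in> set f" "y' \<in> set d"
          using \<open>x \<in> _\<close> \<open>y \<in> _\<close> by auto
        then show ?thesis
          using e(5)[of y' x'] small[of x'] e(1) by auto
      qed
    qed
    ultimately show False
      using Q by (auto simp: avoids_all_def)
  qed
  define p' where "p' w x = p (?rc w) (?N w - x)" for w x
  define q' where "q' w x = q (?rc w) (?N w - x)" for w x
  have pos: "map (p' w) w = rev (map (p (?rc w)) (?rc w))" for w
    unfolding p'_def by (simp add: reverse_complement_def rev_map comp_def)
  show ?thesis
    unfolding codable_def
  proof (rule exI[of _ p'], rule exI[of _ q'], intro conjI allI impI)
    fix w x assume "?Q w" "distinct w" "x \<in> set w"
    then show "p' w x < Suc m" "q' w x < Suc m"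
      using r[OF Q_P dist, of w "?N w - x"] by (auto simp: p'_def q'_def set_rc)
  next
    fix w w' assume w: "?Q w" "distinct w" and w': "?Q w'" "distinct w'" and sets: "set w = set w'"
      and p: "map (p' w) w = map (p' w') w'" and q: "\<forall>x\<in>set w. q' w x = q' w' x"
    have "?rc w = ?rc w'"
    proof (rule u[OF Q_P[OF w(1)] Q_P[OF w'(1)] dist[OF w(2)] dist[OF w'(2)]])
      show "set (?rc w) = set (?rc w')"
        using sets by (simp add: set_rc)
      show "map (p (?rc w)) (?rc w) = map (p (?rc w')) (?rc w')"
        using p by (simp only: pos rev_is_rev_conv)
      show "\<forall>x\<in>set (?rc w). q (?rc w) x = q (?rc w') x"
        using q sets by (simp add: set_rc q'_def)
    qed
    then have "rev (map (\<lambda>x. ?N w - x) (?rc w)) = rev (map (\<lambda>x. ?N w' - x) (?rc w'))"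
      by (simp only: sets)
    then show "w = w'"
      by (simp only: inverse)
  qed
qed

section \<open>Layered patterns\<close>

fun layered_words :: "nat list \<Rightarrow> nat list set" where
  "layered_words [] = {[]}"
| "layered_words (k # ks) = decreasing_words k \<oplus> layered_words ks"

lemma decreasing_words_0: "decreasing_words 0 \<oplus> S = S"
  by (auto simp: direct_sum_def decreasing_words_def)

lemma direct_sum_Nil: "S \<oplus> {[]} = S"
  by (auto simp: direct_sum_def)

lemma avoids_all_weaken:
  assumes "avoids_all S w" "\<And>t. t \<in> T \<Longrightarrow> \<exists>s\<in>S. subseq s t"
  shows "avoids_all T w"
  using assms unfolding avoids_all_def by (meson subseq_order.trans)

lemma subseq_prefix_sum:
  assumes "t \<in> S \<oplus> T"
  shows "\<exists>s\<in>T. subseq s t"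
proof -
  obtain s r where "t = s @ r" "r \<in> T"
    by (rule direct_sumE[OF assms])
  moreover have "subseq r (s @ r)"
    by (rule subseq_appendD) (rule subseq_order.refl)
  ultimately show ?thesis by blast
qed

lemma subseq_middle_sum:
  assumes "t \<in> S \<oplus> M \<oplus> T"
  shows "\<exists>s\<in>S \<oplus> T. subseq s t"
proof -
  obtain s v where s: "t = s @ v" "s \<in> S" "v \<in> M \<oplus> T" "\<And>x y. x \<in> set s \<Longrightarrow> y \<in> set v \<Longrightarrow> x < y"
    using direct_sumE[OF assms] by metis
  obtain m r where "v = m @ r" "r \<in> T"
    by (rule direct_sumE[OF s(3)])
  then have t: "t = s @ m @ r" "s \<in> S" "r \<in> T" "\<And>x y. x \<in> set s \<Longrightarrow> y \<in> set (m @ r) \<Longrightarrow> x < y"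
    using s by auto
  then have "s @ r \<in> S \<oplus> T"
    by (intro direct_sumI) auto
  moreover have "subseq (s @ r) t"
    unfolding t(1) by (intro list_emb_append_mono) auto
  ultimately show ?thesis by blast
qed

lemma codable_split:
  assumes "[] \<notin> T" "codable c1 (avoids_all (S \<oplus> T))" "codable c2 (avoids_all (T \<oplus> R))"
  shows "codable (c1 + c2) (avoids_all (S \<oplus> T \<oplus> R))"
  using codable_merge[OF assms(2,3) avoider_splits[OF _ assms(1)]] by blast

text \<open>
  The leading letter \<open>1\<close> makes the induction work: the second splitting leaves behind the same
  kind of pattern with one layer fewer.
\<close>
lemma codable_one_layered:
  "codable (2 * sum_list ks) (avoids_all (decreasing_words 1 \<oplus> layered_words ks))"
proof (induction ks)
  case Nil
  have "w = []" if "avoids_all (decreasing_words 1 \<oplus> layered_words []) w" for w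
  proof (cases w)
    case (Cons x v)
    then have "subseq [x] w" "[x] \<in> decreasing_words 1 \<oplus> layered_words []"
      by (auto simp: direct_sum_Nil decreasing_words_def)
    then show ?thesis
      using that by (auto simp: avoids_all_def)
  qed
  then show ?case
    unfolding codable_def by fastforce
next
  case (Cons k ks)
  let ?one = "decreasing_words 1"
  show ?case
  proof (cases k)
    case 0
    then show ?thesis
      using Cons by (simp add: decreasing_words_0)
  next
    case (Suc m)
    let ?D = "decreasing_words (Suc m)" and ?L = "layered_words ks"
    have D: "[] \<notin> ?D" and one: "[] \<notin> ?one"
      by (auto simp: decreasing_words_def)
    have "codable (Suc m + 2 * sum_list ks) (avoids_all (?D \<oplus> ?one \<oplus> ?L))"
      by (rule codable_split[OF one codable_decreasing_one Cons])
    then have "codable (Suc m + 2 * sum_list ks) (avoids_all (?D \<oplus> ?L))"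
      by (rule codable_mono) (auto intro: avoids_all_weaken subseq_middle_sum)
    then have "codable (Suc m + (Suc m + 2 * sum_list ks)) (avoids_all (?one \<oplus> ?D \<oplus> ?L))"
      by (rule codable_split[OF D codable_one_decreasing])
    then show ?thesis
      using Suc by (simp add: algebra_simps)
  qed
qed

corollary codable_layered: "codable (2 * sum_list ks) (avoids_all (layered_words ks))"
  by (rule codable_mono[OF codable_one_layered]) (auto intro: avoids_all_weaken subseq_prefix_sum)

lemma subseq_embedding:
  assumes "subseq s w"
  shows "\<exists>f. strict_mono_on {..<length s} f \<and> (\<forall>i<length s. f i < length w \<and> w ! f i = s ! i)"
  using assms
proof (induction s w rule: list_emb.induct)
  case (list_emb_Nil ys)
  then show ?case
    by (auto simp: strict_mono_on_def)
next
  case (list_emb_Cons xs ys y)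
  then obtain f where f: "strict_mono_on {..<length xs} f" "\<forall>i<length xs. f i < length ys \<and> ys ! f i = xs ! i"
    by blast
  then show ?case
    by (intro exI[of _ "\<lambda>i. Suc (f i)"]) (auto simp: strict_mono_on_def)
next
  case (list_emb_Cons2 x y xs ys)
  then obtain f where f: "strict_mono_on {..<length xs} f" "\<forall>i<length xs. f i < length ys \<and> ys ! f i = xs ! i"
    by blast
  let ?g = "\<lambda>i. case i of 0 \<Rightarrow> 0 | Suc j \<Rightarrow> Suc (f j)"
  show ?case
    using f list_emb_Cons2(1)
    by (intro exI[of _ ?g]) (auto simp: strict_mono_on_def nth_Cons split: nat.split)
qed

lemma length_layered_words: "s \<in> layered_words ks \<Longrightarrow> length s = sum_list ks"
  by (induction ks arbitrary: s) (auto simp: decreasing_words_def elim!: direct_sumE)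

lemma layered_words_order_isomorphic:
  assumes "s \<in> layered_words ks" "t \<in> layered_words ks" "i < length s" "j < length s"
  shows "s ! i < s ! j \<longleftrightarrow> t ! i < t ! j"
  using assms
proof (induction ks arbitrary: s t i j)
  case (Cons k ks)
  obtain s1 s2 where s: "s = s1 @ s2" "s1 \<in> decreasing_words k" "s2 \<in> layered_words ks"
    "\<And>x y. x \<in> set s1 \<Longrightarrow> y \<in> set s2 \<Longrightarrow> x < y"
    using Cons.prems(1) by (auto elim!: direct_sumE)
  obtain t1 t2 where t: "t = t1 @ t2" "t1 \<in> decreasing_words k" "t2 \<in> layered_words ks"
    "\<And>x y. x \<in> set t1 \<Longrightarrow> y \<in> set t2 \<Longrightarrow> x < y"
    using Cons.prems(2) by (auto elim!: direct_sumE)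
  have len: "length s1 = k" "length t1 = k" "length t2 = length s2"
    using s t length_layered_words by (auto simp: decreasing_words_def)
  have dec: "d ! i < d ! j \<longleftrightarrow> j < i" if "d \<in> decreasing_words k" "i < k" "j < k" for d i j
  proof -
    have *: "d ! b < d ! a" if "a < b" "b < k" for a b
      using \<open>d \<in> _\<close> that by (auto simp: decreasing_words_def sorted_wrt_iff_nth_less)
    show ?thesis
      using *[of i j] *[of j i] that by (cases i j rule: linorder_cases) auto
  qed
  consider "i < k" "j < k" | "i < k" "k \<le> j" | "k \<le> i" "j < k" | "k \<le> i" "k \<le> j"
    by linarith
  then show ?case
  proof cases
    case 1
    then show ?thesis
      using dec s t len by (simp add: nth_append)
  next
    case 2
    then have "s1 ! i < s2 ! (j - k)" "t1 ! i < t2 ! (j - k)"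
      using s t len Cons.prems(4) by auto
    then show ?thesis
      using 2 s(1) t(1) len by (simp add: nth_append)
  next
    case 3
    then have "s1 ! j < s2 ! (i - k)" "t1 ! j < t2 ! (i - k)"
      using s t len Cons.prems(3) by auto
    then show ?thesis
      using 3 s(1) t(1) len by (simp add: nth_append)
  next
    case 4
    then show ?thesis
      using Cons.IH[OF s(3) t(3), of "i - k" "j - k"] Cons.prems(3,4) s(1) t(1) len
      by (auto simp: nth_append)
  qed
qed simp

lemma avoids_pattern_layered:
  assumes "\<tau> \<in> layered_words ks" "avoids_pattern \<pi> \<tau>"
  shows "avoids_all (layered_words ks) \<pi>"
  unfolding avoids_all_def
proof (intro ballI notI)
  fix s assume s: "s \<in> layered_words ks" "subseq s \<pi>"
  have len: "length s = length \<tau>"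
    using s assms by (simp add: length_layered_words)
  obtain f where f: "strict_mono_on {..<length s} f" "\<forall>i<length s. f i < length \<pi> \<and> \<pi> ! f i = s ! i"
    using subseq_embedding[OF s(2)] by blast
  have "contains_pattern \<pi> \<tau>"
    unfolding contains_pattern_def
    using f len layered_words_order_isomorphic[OF s(1) assms(1)] by (intro exI[of _ f]) auto
  then show False
    using assms(2) by (simp add: avoids_pattern_def)
qed

lemma layered_in_layered_words:
  assumes "layered \<tau>"
  shows "\<exists>ks. \<tau> \<in> layered_words ks \<and> sum_list ks = length \<tau>"
proof -
  obtain layers where l: "\<tau> = concat layers" "\<forall>s\<in>set layers. sorted_wrt (>) s"
    "sorted_wrt (\<lambda>s t. \<forall>x\<in>set s. \<forall>y\<in>set t. x < y) layers"
    using assms by (auto simp: layered_def)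
  have "concat layers \<in> layered_words (map length layers)"
    using l(2,3)
  proof (induction layers)
    case (Cons a layers)
    then show ?case
      by (auto simp: decreasing_words_def intro!: direct_sumI)
  qed simp
  then show ?thesis
    using l(1) length_layered_words by metis
qed

lemma num_avoiders_layered_le:
  assumes "layered \<tau>"
  shows "num_avoiders n \<tau> \<le> (4 * (length \<tau>)\<^sup>2) ^ n"
proof -
  obtain ks where ks: "\<tau> \<in> layered_words ks" "sum_list ks = length \<tau>"
    using layered_in_layered_words[OF assms] by blast
  have "num_avoiders n \<tau> \<le> card {\<pi> \<in> permutations_of_set {1..n}. avoids_all (layered_words ks) \<pi>}"
    unfolding num_avoiders_def using avoids_pattern_layered[OF ks(1)] by (intro card_mono) auto
  also have "\<dots> \<le> ((2 * sum_list ks)\<^sup>2) ^ n"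
    by (rule card_codable[OF codable_layered])
  finally show ?thesis
    using ks(2) by (simp add: power_mult_distrib)
qed

section \<open>Existence of the limit\<close>

text \<open>
  An occurrence in a concatenation that is contained in neither part has its first letter in \<open>a\<close> and its last
  letter in \<open>b\<close>.
\<close>
lemma contains_pattern_append:
  assumes "contains_pattern (a @ b) \<tau>" "\<tau> \<noteq> []"
  shows "contains_pattern a \<tau> \<or> contains_pattern b \<tau> \<or>
    (\<exists>x\<in>set a. \<exists>y\<in>set b. (x < y \<longleftrightarrow> hd \<tau> < last \<tau>) \<and> (y < x \<longleftrightarrow> last \<tau> < hd \<tau>))"
proof -
  let ?l = "length \<tau>"
  obtain f where f: "strict_mono_on {..<?l} f" "\<forall>i<?l. f i < length (a @ b)"
    "\<forall>i<?l. \<forall>j<?l. (a @ b) ! f i < (a @ b) ! f j \<longleftrightarrow> \<tau> ! i < \<tau> ! j"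
    using assms(1) unfolding contains_pattern_def by blast
  have mono: "f i \<le> f j" if "i \<le> j" "j < ?l" for i j
    using f(1) that by (cases "i = j") (auto simp: strict_mono_on_def intro: less_imp_le)
  have l: "0 < ?l" "?l - 1 < ?l"
    using assms(2) by auto
  consider (left) "f (?l - 1) < length a" | (right) "length a \<le> f 0" | (mid) "f 0 < length a" "length a \<le> f (?l - 1)"
    by linarith
  then show ?thesis
  proof cases
    case left
    have "f i < length a" if "i < ?l" for i
    proof -
      have "f i \<le> f (?l - 1)"
        using that by (intro mono) auto
      then show ?thesis
        using left by (rule order.strict_trans1)
    qed
    then have "contains_pattern a \<tau>"
      unfolding contains_pattern_def using f by (intro exI[of _ f]) (auto simp: nth_append)
    then show ?thesis by simp
  next
    case right
    then have ge: "length a \<le> f i" if "i < ?l" for i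
      using mono[of 0 i] that by auto
    have "contains_pattern b \<tau>"
      unfolding contains_pattern_def
    proof (intro exI[of _ "\<lambda>i. f i - length a"] conjI allI impI)
      show "strict_mono_on {..<?l} (\<lambda>i. f i - length a)"
        using f(1) ge by (auto simp: strict_mono_on_def intro!: diff_less_mono)
      show "f i - length a < length b" if "i < ?l" for i
        using f(2) ge that by (auto simp: less_diff_conv2)
      show "(b ! (f i - length a) < b ! (f j - length a)) = (\<tau> ! i < \<tau> ! j)" if "i < ?l" "j < ?l" for i j
        using f(3)[rule_format, OF that] ge[OF that(1)] ge[OF that(2)] by (simp add: nth_append)
    qed
    then show ?thesis by simp
  next
    case mid
    let ?x = "a ! f 0" and ?y = "b ! (f (?l - 1) - length a)"
    have "?x \<in> set a"
      using mid(1) by simp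
    moreover have "f (?l - 1) - length a < length b"
      using f(2)[rule_format, OF l(2)] mid(2) unfolding length_append by linarith
    then have "?y \<in> set b"
      by simp
    moreover have "(?x < ?y \<longleftrightarrow> hd \<tau> < last \<tau>) \<and> (?y < ?x \<longleftrightarrow> last \<tau> < hd \<tau>)"
      using f(3)[rule_format, OF l] f(3)[rule_format, OF l(2,1)] mid assms(2)
      by (simp add: nth_append hd_conv_nth last_conv_nth)
    ultimately show ?thesis by blast
  qed
qed

lemma contains_pattern_shift: "contains_pattern (map (\<lambda>x. x + k) \<pi>) \<tau> \<longleftrightarrow> contains_pattern \<pi> \<tau>"
proof -
  have "(\<forall>i<length \<tau>. f i < length (map (\<lambda>x. x + k) \<pi>)) \<and>
      (\<forall>i<length \<tau>. \<forall>j<length \<tau>. map (\<lambda>x. x + k) \<pi> ! f i < map (\<lambda>x. x + k) \<pi> ! f j \<longleftrightarrow> \<tau> ! i < \<tau> ! j) \<longleftrightarrow>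
    (\<forall>i<length \<tau>. f i < length \<pi>) \<and> (\<forall>i<length \<tau>. \<forall>j<length \<tau>. \<pi> ! f i < \<pi> ! f j \<longleftrightarrow> \<tau> ! i < \<tau> ! j)" for f
    by auto
  then show ?thesis
    unfolding contains_pattern_def by simp
qed

text \<open>
  Two avoiders are glued so that the letters of one part all lie on that side of the letters of the other part
  which contradicts the order of the first and the last letter of the pattern.
\<close>
lemma num_avoiders_supermult:
  assumes "\<tau> \<noteq> []" "hd \<tau> \<noteq> last \<tau>"
  shows "num_avoiders m \<tau> * num_avoiders n \<tau> \<le> num_avoiders (m + n) \<tau>"
proof -
  define Av where "Av k = {\<pi> \<in> permutations_of_set {1..k}. avoids_pattern \<pi> \<tau>}" for k
  define c where "c = (if hd \<tau> < last \<tau> then n else 0)"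
  define d where "d = (if hd \<tau> < last \<tau> then 0 else m)"
  define glue where "glue = (\<lambda>(\<pi>, \<sigma>). map (\<lambda>x. x + c) \<pi> @ map (\<lambda>x. x + d) \<sigma>)"
  have Av: "set \<pi> = {1..k}" "distinct \<pi>" "\<not> contains_pattern \<pi> \<tau>" "length \<pi> = k" if "\<pi> \<in> Av k" for \<pi> k
    using that permutations_of_setD[of \<pi> "{1..k}"] distinct_card[of \<pi>] by (auto simp: Av_def avoids_pattern_def)
  have inj: "inj_on glue (Av m \<times> Av n)"
  proof (rule inj_onI, clarify)
    fix \<pi> \<sigma> \<pi>' \<sigma>' assume *: "\<pi> \<in> Av m" "\<sigma> \<in> Av n" "\<pi>' \<in> Av m" "\<sigma>' \<in> Av n" "glue (\<pi>, \<sigma>) = glue (\<pi>', \<sigma>')"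
    then have "map (\<lambda>x. x + c) \<pi> = map (\<lambda>x. x + c) \<pi>'" "map (\<lambda>x. x + d) \<sigma> = map (\<lambda>x. x + d) \<sigma>'"
      using Av(4)[OF *(1)] Av(4)[OF *(3)] by (simp_all add: glue_def)
    moreover have "inj (\<lambda>x :: nat. x + k)" for k
      by (simp add: inj_def)
    ultimately show "\<pi> = \<pi>' \<and> \<sigma> = \<sigma>'"
      by (metis inj_map_eq_map)
  qed
  have into: "glue ` (Av m \<times> Av n) \<subseteq> Av (m + n)"
  proof clarify
    fix \<pi> \<sigma> assume *: "\<pi> \<in> Av m" "\<sigma> \<in> Av n"
    let ?a = "map (\<lambda>x. x + c) \<pi>" and ?b = "map (\<lambda>x. x + d) \<sigma>"
    have sets: "set ?a = {c + 1..c + m}" "set ?b = {d + 1..d + n}"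
      using Av(1)[OF *(1)] Av(1)[OF *(2)] by (simp_all add: add.commute[of _ c] add.commute[of _ d])
    have perm: "?a @ ?b \<in> permutations_of_set {1..m + n}"
    proof (rule permutations_of_setI)
      show "set (?a @ ?b) = {1..m + n}"
        unfolding set_append sets by (auto simp: c_def d_def)
      show "distinct (?a @ ?b)"
        unfolding distinct_append sets using Av(2)[OF *(1)] Av(2)[OF *(2)]
        by (auto simp: distinct_map c_def d_def)
    qed
    have "\<not> contains_pattern (?a @ ?b) \<tau>"
    proof
      assume "contains_pattern (?a @ ?b) \<tau>"
      from contains_pattern_append[OF this assms(1)]
      obtain x y where "x \<in> set ?a" "y \<in> set ?b" "x < y \<longleftrightarrow> hd \<tau> < last \<tau>" "y < x \<longleftrightarrow> last \<tau> < hd \<tau>"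
        using Av(3)[OF *(1)] Av(3)[OF *(2)] unfolding contains_pattern_shift by blast
      then show False
        unfolding sets using assms(2) by (auto simp: c_def d_def split: if_splits)
    qed
    then show "glue (\<pi>, \<sigma>) \<in> Av (m + n)"
      using perm by (simp add: Av_def glue_def avoids_pattern_def)
  qed
  have "card (Av m \<times> Av n) \<le> card (Av (m + n))"
    by (rule card_inj_on_le[OF inj into]) (simp add: Av_def)
  then show ?thesis
    unfolding Av_def num_avoiders_def by (simp add: card_cartesian_product)
qed

lemma num_avoiders_pos:
  assumes "length \<tau> \<ge> 2" "hd \<tau> \<noteq> last \<tau>"
  shows "num_avoiders n \<tau> > 0"
proof (induction n)
  have short: "avoids_pattern \<pi> \<tau>" if "length \<pi> < 2" for \<pi>
  proof -
    have "False" if "strict_mono_on {..<length \<tau>} f" "\<forall>i<length \<tau>. f i < length \<pi>" for f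
    proof -
      have "f 0 < f 1"
        by (rule strict_mono_onD[OF that(1)]) (use assms(1) in auto)
      moreover have "f 1 < length \<pi>"
        using that(2) assms(1) by simp
      ultimately show False
        using \<open>length \<pi> < 2\<close> by simp
    qed
    then show ?thesis
      unfolding avoids_pattern_def contains_pattern_def by blast
  qed
  have "[] \<in> {\<pi> \<in> permutations_of_set {1..0}. avoids_pattern \<pi> \<tau>}"
    "[1] \<in> {\<pi> \<in> permutations_of_set {1..1}. avoids_pattern \<pi> \<tau>}"
    using short by (auto intro!: permutations_of_setI)
  then have "num_avoiders 0 \<tau> > 0" and one: "num_avoiders 1 \<tau> > 0"
    unfolding num_avoiders_def by (auto simp: card_gt_0_iff)
  then show "num_avoiders 0 \<tau> > 0" by simp
  fix n assume "num_avoiders n \<tau> > 0"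
  then have "0 < num_avoiders n \<tau> * num_avoiders 1 \<tau>"
    using one by simp
  also have "\<dots> \<le> num_avoiders (n + 1) \<tau>"
    using assms by (intro num_avoiders_supermult) auto
  finally show "num_avoiders (Suc n) \<tau> > 0" by simp
qed

text \<open>The limit is the supremum of the quotients: division with remainder by \<open>m\<close> bounds a late
  quotient from below by the \<open>m\<close>-th one, up to an error of order \<open>1 / n\<close>.\<close>
lemma fekete:
  fixes x :: "nat \<Rightarrow> real"
  assumes super: "\<And>m n. x m + x n \<le> x (m + n)" and nonneg: "\<And>n. 0 \<le> x n"
    and bound: "\<And>n. x n \<le> K * real n"
  shows "convergent (\<lambda>n. x n / real n)"
proof -
  define L where "L = (SUP n\<in>{0<..}. x n / real n)"
  have bdd: "bdd_above ((\<lambda>n. x n / real n) ` {0<..})"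
    using bound by (intro bdd_aboveI[of _ K]) (auto simp: divide_simps)
  have upper: "x n / real n \<le> L" if "n > 0" for n
    unfolding L_def using that by (intro cSUP_upper bdd) auto
  have mult: "real q * x m \<le> x (q * m + r)" for q m r
  proof (induction q)
    case 0
    then show ?case using nonneg by simp
  next
    case (Suc q)
    then show ?case
      using super[of m "q * m + r"] by (simp add: algebra_simps)
  qed
  have lower: "x m / real m - x m / real n \<le> x n / real n" if "m > 0" "n > 0" for m n
  proof -
    have "n \<le> (n div m + 1) * m"
      using that(1) by (metis add.commute less_imp_le mod_less_divisor mult.commute mult_Suc_right
          add_le_mono1 mult_div_mod_eq plus_1_eq_Suc nat_add_left_cancel_le)
    then have "real n \<le> (real (n div m) + 1) * real m"
      by (metis of_nat_1 of_nat_add of_nat_le_iff of_nat_mult)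
    then have "real n / real m \<le> real (n div m) + 1"
      using that by (simp add: divide_simps)
    then have "x m * (real n / real m) \<le> x m * (real (n div m) + 1)"
      using nonneg by (intro mult_left_mono)
    also have "\<dots> \<le> x m + x n"
      using mult[of "n div m" m "n mod m"] by (simp add: algebra_simps)
    finally have "x m * (real n / real m) / real n \<le> (x m + x n) / real n"
      by (intro divide_right_mono) auto
    then show ?thesis
      using that by (simp add: add_divide_distrib)
  qed
  have "(\<lambda>n. x n / real n) \<longlonglongrightarrow> L"
  proof (rule order_tendstoI)
    fix y assume "y < L"
    then obtain m where m: "m > 0" "y < x m / real m"
      unfolding L_def using less_cSUP_iff[OF _ bdd] by auto
    have "(\<lambda>n. x m / real m - x m / real n) \<longlonglongrightarrow> x m / real m - 0"
      by (intro tendsto_intros lim_const_over_n)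
    then have "\<forall>\<^sub>F n in sequentially. y < x m / real m - x m / real n"
      using m(2) by (intro order_tendstoD(1)) auto
    then show "\<forall>\<^sub>F n in sequentially. y < x n / real n"
      using eventually_gt_at_top[of "0 :: nat"]
    proof eventually_elim
      case (elim n)
      then show ?case
        using lower[OF m(1), of n] by simp
    qed
  next
    fix y assume "L < y"
    then show "\<forall>\<^sub>F n in sequentially. x n / real n < y"
    proof (intro eventually_sequentiallyI[of 1])
      fix n :: nat assume "1 \<le> n"
      then show "x n / real n < y"
        using upper[of n] \<open>L < y\<close> by simp
    qed
  qed
  then show ?thesis
    by (auto simp: convergent_def)
qed

lemma convergent_root_num_avoiders:
  assumes "length \<tau> \<ge> 2" "hd \<tau> \<noteq> last \<tau>" "\<And>n. num_avoiders n \<tau> \<le> C ^ n" "C > 0"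
  shows "convergent (\<lambda>n. root n (real (num_avoiders n \<tau>)))"
proof -
  let ?x = "\<lambda>n. ln (real (num_avoiders n \<tau>))"
  note pos = num_avoiders_pos[OF assms(1,2)]
  have "convergent (\<lambda>n. ?x n / real n)"
  proof (rule fekete)
    show "?x m + ?x n \<le> ?x (m + n)" for m n
    proof -
      have "real (num_avoiders m \<tau> * num_avoiders n \<tau>) \<le> real (num_avoiders (m + n) \<tau>)"
        unfolding of_nat_le_iff using assms(1,2) by (intro num_avoiders_supermult) auto
      then have "ln (real (num_avoiders m \<tau> * num_avoiders n \<tau>)) \<le> ?x (m + n)"
        using pos by (subst ln_le_cancel_iff) simp_all
      then show ?thesis
        using pos by (simp add: ln_mult)
    qed
    show "0 \<le> ?x n" for n
      using pos[of n] by (intro ln_ge_zero) simp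
    show "?x n \<le> ln (real C) * real n" for n
    proof -
      have "real (num_avoiders n \<tau>) \<le> real C ^ n"
        using assms(3)[of n] by (metis of_nat_le_iff of_nat_power)
      then have "?x n \<le> ln (real C ^ n)"
        using pos assms(4) by simp
      then show ?thesis
        using assms(4) by (simp add: ln_realpow mult.commute)
    qed
  qed
  then have "convergent (\<lambda>n. exp (?x n / real n))"
    unfolding convergent_def using tendsto_exp by blast
  moreover have "\<forall>\<^sub>F n in sequentially. exp (?x n / real n) = root n (real (num_avoiders n \<tau>))"
    using pos by (intro eventually_sequentiallyI[of 1]) (simp add: root_powr_inverse powr_def)
  ultimately show ?thesis
    using convergent_cong by fast
qed

theorem corollary7:
  fixes \<tau> :: "nat list" and l :: nat
  assumes "l \<ge> 1"
    and "\<tau> \<in> permutations_of_set {1..l}"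
    and "layered \<tau>"
  shows "stanley_wilf_limit \<tau> \<le> 4 * (real l)\<^sup>2"
proof -
  let ?r = "\<lambda>n. root n (real (num_avoiders n \<tau>))"
  have \<tau>: "set \<tau> = {1..l}" "distinct \<tau>"
    using permutations_of_setD[OF assms(2)] by auto
  then have len: "length \<tau> = l"
    using distinct_card[of \<tau>] by simp
  have bound: "num_avoiders n \<tau> \<le> (4 * l\<^sup>2) ^ n" for n
    using num_avoiders_layered_le[OF assms(3)] len by simp
  \<comment> \<open>for \<open>l = 1\<close> the first and last letter of the pattern agree, and there are no nonempty avoiders\<close>
  have "convergent ?r"
  proof (cases "l = 1")
    case True
    have "num_avoiders n \<tau> = 0" if "n > 0" for n
    proof -
      have "contains_pattern \<pi> \<tau>" if "\<pi> \<in> permutations_of_set {1..n}" for \<pi>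
        using permutations_of_setD(1)[OF that] \<open>n > 0\<close> True len unfolding contains_pattern_def
        by (intro exI[of _ "\<lambda>_. 0"]) (auto simp: strict_mono_on_def)
      then show ?thesis
        unfolding num_avoiders_def avoids_pattern_def by (auto simp: card_eq_0_iff)
    qed
    then have "\<forall>\<^sub>F n in sequentially. ?r n = 0"
      by (intro eventually_sequentiallyI[of 1]) simp
    then show ?thesis
      unfolding convergent_def by (intro exI[of _ 0] tendsto_eventually)
  next
    case False
    then have "length \<tau> \<ge> 2"
      using len assms(1) by simp
    moreover have "hd \<tau> \<noteq> last \<tau>"
    proof -
      have "\<tau> ! 0 \<noteq> \<tau> ! (l - 1)"
        using \<tau>(2) len False assms(1) by (subst nth_eq_iff_index_eq) auto
      moreover have "\<tau> \<noteq> []"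
        using len assms(1) by auto
      ultimately show ?thesis
        by (simp add: hd_conv_nth last_conv_nth len)
    qed
    ultimately show ?thesis
      using assms(1) by (intro convergent_root_num_avoiders[OF _ _ bound]) auto
  qed
  then have "?r \<longlonglongrightarrow> stanley_wilf_limit \<tau>"
    by (simp add: stanley_wilf_limit_def convergent_LIMSEQ_iff)
  moreover have "?r n \<le> 4 * (real l)\<^sup>2" if "n \<ge> 1" for n
  proof -
    have "real (num_avoiders n \<tau>) \<le> (4 * (real l)\<^sup>2) ^ n"
      using of_nat_mono[OF bound[of n], where ?'a = real] by simp
    then have "?r n \<le> root n ((4 * (real l)\<^sup>2) ^ n)"
      using that by simp
    also have "\<dots> = 4 * (real l)\<^sup>2"
      using that by (intro real_root_power_cancel) auto
    finally show ?thesis .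
  qed
  ultimately show ?thesis
    by (intro LIMSEQ_le_const2) auto
qed

end
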